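(* Let $-D\ne -23$ be a (negative) fundamental discriminant such that $h(-D)=2k+1$ is an odd integer greater than $1$. Let $Q_0,Q_1,\bar Q_1,\ldots,Q_k,\bar Q_k$ be the distinct reduced forms of discriminant $-D$, with $Q_0$ the principal form and $\bar Q_i$ the conjugate of $Q_i$. Let $1\le r\le k$ and $$F_{D,r}(z)=\frac12\left(\sum_{a,b\in\mathbb{Z}}q^{Q_0(a,b)}-\sum_{a,b\in\mathbb{Z}}q^{Q_r(a,b)}\right),$$ and let $(c(n))_{n\ge1}$ be the integers such that, for sufficiently small $|q|$, $$F_{D,r}(z)=q\prod_{n=1}^\infty(1-q^n)^{c(n)}.$$ Then the integers $c(n)$ are unbounded. More generally, for any $\alpha\in\mathbb{R}$, the sequence $$\frac{1}{n^\alpha}\sum_{d\mid n}d\,c(d)\qquad(n\ge 1)$$ is not bounded.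
   Context: A primitive positive definite integral binary quadratic form $ax^2+bxy+cy^2$ has discriminant $b^2-4ac$; it is reduced if $|b|\le a\le c$, and $b\ge 0$ whenever $|b|=a$ or $a=c$. The conjugate of $ax^2+bxy+cy^2$ is $ax^2-bxy+cy^2$. The class number $h(-D)$ is the number of proper ($\mathrm{SL}_2(\mathbb{Z})$-)equivalence classes of primitive positive definite forms of discriminant $-D$; each class contains exactly one reduced form. For a negative discriminant $d$ the principal form is $x^2-\frac d4y^2$ if $d\equiv 0\pmod 4$ and $x^2+xy+\frac{1-d}{4}y^2$ if $d\equiv 1\pmod 4$. When $h(-D)=2k+1$ is odd, the reduced forms of discriminant $-D$ are the principal form together with $k$ pairs of distinct conjugate forms, so they can be listed as in the claim. Here $q=e^{2\pi iz}$ with $z$ in the upper half-plane. The function $F_{D,r}$ has a $q$-expansion $q+O(q^2)$ with integer coefficients. By a known result of Eholzer and Skoruppa, a holomorphic function $f$ on the upper half-plane with $f(z+1)=f(z)$ and Fourier expansion $\sum_{n\ge0}a_f(n)q^n$, $a_f(0)=1$, has a unique sequence of complex numbers $c(n)$ with $f(z)=\prod_{n\ge1}(1-q^n)^{c(n)}$ for sufficiently small $|q|$, and the $c(n)$ are integers if $f$ has integral Fourier coefficients; applied to $F_{D,r}/q$ this gives the existence and uniqueness of the integers $c(n)$ in the claim. *)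

theory Defs
  imports
    "HOL-Analysis.Analysis"
    "HOL-Computational_Algebra.Computational_Algebra"
begin

datatype qform = QForm int int int

primrec qform_eval :: "qform \<Rightarrow> int \<Rightarrow> int \<Rightarrow> int" where
  "qform_eval (QForm a b c) x y = a * x\<^sup>2 + b * x * y + c * y\<^sup>2"

primrec qform_disc :: "qform \<Rightarrow> int" where
  "qform_disc (QForm a b c) = b\<^sup>2 - 4 * a * c"

primrec qform_primitive :: "qform \<Rightarrow> bool" where
  "qform_primitive (QForm a b c) \<longleftrightarrow> gcd a (gcd b c) = 1"

definition qform_pos_def :: "qform \<Rightarrow> bool" where
  "qform_pos_def Q \<longleftrightarrow> (\<forall>x y. (x, y) \<noteq> (0, 0) \<longrightarrow> qform_eval Q x y > 0)"

primrec qform_reduced :: "qform \<Rightarrow> bool" where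
  "qform_reduced (QForm a b c) \<longleftrightarrow>
     \<bar>b\<bar> \<le> a \<and> a \<le> c \<and> (\<bar>b\<bar> = a \<or> a = c \<longrightarrow> b \<ge> 0)"

primrec qform_conj :: "qform \<Rightarrow> qform" where
  "qform_conj (QForm a b c) = QForm a (- b) c"

definition qforms :: "int \<Rightarrow> qform set" where
  "qforms d = {Q. qform_primitive Q \<and> qform_pos_def Q \<and> qform_disc Q = d}"

definition reduced_qforms :: "int \<Rightarrow> qform set" where
  "reduced_qforms d = {Q \<in> qforms d. qform_reduced Q}"

definition properly_equivalent :: "qform \<Rightarrow> qform \<Rightarrow> bool" where
  "properly_equivalent P Q \<longleftrightarrow>
     (\<exists>s t u v. s * v - t * u = 1 \<and>
        (\<forall>x y. qform_eval Q x y = qform_eval P (s * x + t * y) (u * x + v * y)))"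

definition class_number :: "int \<Rightarrow> nat" where
  "class_number d =
     card (qforms d // {(P, Q). P \<in> qforms d \<and> Q \<in> qforms d \<and> properly_equivalent P Q})"

definition principal_qform :: "int \<Rightarrow> qform" where
  "principal_qform d =
     (if d mod 4 = 0 then QForm 1 0 (- (d div 4)) else QForm 1 1 ((1 - d) div 4))"

text \<open>The value 1 also satisfies this predicate; it is only used for negative discriminants.\<close>

definition fundamental_discriminant :: "int \<Rightarrow> bool" where
  "fundamental_discriminant d \<longleftrightarrow>
     d mod 4 = 1 \<and> squarefree d \<or>
     d mod 4 = 0 \<and> squarefree (d div 4) \<and> (d div 4) mod 4 \<in> {2, 3}"

definition nome :: "complex \<Rightarrow> complex" where
  "nome z = exp (2 * of_real pi * \<i> * z)"

definition qform_theta :: "qform \<Rightarrow> complex \<Rightarrow> complex" where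
  "qform_theta Q z = (\<Sum>\<^sub>\<infinity>(a, b) \<in> (UNIV :: (int \<times> int) set). nome z powi qform_eval Q a b)"

definition theta_diff :: "qform \<Rightarrow> qform \<Rightarrow> complex \<Rightarrow> complex" where
  "theta_diff P Q z = (qform_theta P z - qform_theta Q z) / 2"

text \<open>The library indexes infinite products from 0, hence the shift by one.\<close>

definition has_product_exponents :: "(complex \<Rightarrow> complex) \<Rightarrow> (nat \<Rightarrow> int) \<Rightarrow> bool" where
  "has_product_exponents f c \<longleftrightarrow>
     (\<exists>\<epsilon>>0. \<forall>z. Im z > 0 \<and> norm (nome z) < \<epsilon> \<longrightarrow>
        convergent_prod (\<lambda>n. (1 - nome z ^ Suc n) powi c (Suc n)) \<and>
        f z = nome z * (\<Prod>n. (1 - nome z ^ Suc n) powi c (Suc n)))"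

end

theory Submission
  imports Defs "HOL-Complex_Analysis.Complex_Analysis" "HOL-Probability.Probability"
    "HOL-Number_Theory.Number_Theory" "HOL-Real_Asymp.Real_Asymp"
begin

text \<open>Write \<open>F\<close> for the difference of theta series and \<open>b N = (\<Sum>d | d dvd N. d * c d)\<close>, so that near the cusp
  \<open>F\<close> is the exponential of \<open>L z = 2 * pi * \<i> * z - (\<Sum>N. b N / N * q ^ N)\<close>. If \<open>b\<close> grew only polynomially, \<open>L\<close> would be
  holomorphic on the whole upper half-plane, and \<open>F = exp \<circ> L\<close> would have no zeros there. As no
  nonprincipal reduced form is ambiguous, \<open>D\<close> is a prime \<open>p\<close> congruent to 3 modulo 4, and \<open>F\<close> has weight 1
  and level \<open>p\<close>, with order 1 at infinity. Its norm to level 1 is then a zero-free modular form of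
  weight \<open>p + 1\<close> with order 2 at infinity, so \<open>(p + 1) / 12 = 2\<close> and \<open>p = 23\<close>.\<close>

section \<open>Fourier uniqueness and Poisson summation\<close>

text \<open>A difference of theta series inherits a transformation law only if both terms pick up
  the same multiplier. The multiplier is a quadratic Gauss sum twisted by the leading coefficient of
  the form. For a discriminant that is minus a prime there is a single genus: a leading coefficient
  prime to \<open>p\<close> is a square modulo \<open>p\<close> and drops out of the Gauss sum. The
  laws are proved only at the points i t / p and (j + i t) / p with t > 0, where Poisson summation
  concerns real Gaussians; the identity theorem does the rest. The norm is F(z) times the product of
  F((z + j) / p) over 0 <= j < p. The first factor has order 1 at infinity and the other p factors
  have order 1/p each, whence order 2, while p + 1 factors of weight 1 give the weight. Keeping
  logarithms throughout replaces contour integration: the period 4 pi i of the logarithm of the norm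
  records the order. The discriminant -23 is a genuine exception: there F is eta(z) eta(23 z), whose
  product exponents are bounded.\<close>

definition fourier_coeff :: "(real \<Rightarrow> complex) \<Rightarrow> int \<Rightarrow> complex" where
  "fourier_coeff f n = integral {0..1} (\<lambda>x. cis (- 2 * pi * of_int n * x) * f x)"

lemma integral_cis_period:
  "integral {0..1} (\<lambda>x. cis (2 * pi * of_int k * x)) = (if k = 0 then 1 else 0)"
proof (cases "k = 0")
  case True then show ?thesis by simp
next
  case False
  define F where "F = (\<lambda>x::real. cis (2 * pi * of_int k * x) / (2 * of_real pi * \<i> * of_int k))"
  have "((\<lambda>x. cis (2 * pi * of_int k * x)) has_integral F 1 - F 0) {0..1}"
  proof (rule fundamental_theorem_of_calculus)
    fix x :: real
    show "(F has_vector_derivative cis (2 * pi * of_int k * x)) (at x within {0..1})"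
      unfolding F_def cis_conv_exp
      using False
      by (auto intro!: derivative_eq_intros has_vector_derivative_real_field simp: field_simps)
  qed simp
  moreover have "F 1 = F 0"
    using cis_multiple_2pi[of "of_int k"] by (simp add: F_def)
  ultimately show ?thesis using False by (simp add: integral_unique)
qed

lemma fourier_coeff_diff:
  assumes "continuous_on {0..1} f" "continuous_on {0..1} g"
  shows "fourier_coeff (\<lambda>x. f x - g x) n = fourier_coeff f n - fourier_coeff g n"
  unfolding fourier_coeff_def right_diff_distrib
  by (intro integral_diff integrable_continuous_interval continuous_intros assms)

lemma fourier_coeff_cis:
  "fourier_coeff (\<lambda>x. c * cis (2 * pi * of_int m * x)) n = (if m = n then c else 0)"
proof -
  have "(\<lambda>x. cis (- 2 * pi * of_int n * x) * (c * cis (2 * pi * of_int m * x))) =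
      (\<lambda>x. c * cis (2 * pi * of_int (m - n) * x))"
    by (intro ext) (simp add: cis_mult algebra_simps)
  then show ?thesis
    unfolding fourier_coeff_def by (simp only: integral_mult_right integral_cis_period) auto
qed

text \<open>Induction on \<open>A\<close> with \<open>g\<close> generalised: subtracting the
  component \<open>e\<close> of \<open>g\<close> along one character leaves the coefficients at the
  other indices alone and lowers the squared norm by exactly the square of
  \<open>norm c\<close>.\<close>

lemma bessel_inequality:
  assumes "finite A" "continuous_on {0..1} g"
  shows "(\<Sum>n\<in>A. (norm (fourier_coeff g n))\<^sup>2) \<le> integral {0..1} (\<lambda>x. (norm (g x))\<^sup>2)"
  using assms
proof (induction A arbitrary: g rule: finite_induct)
  case empty
  then show ?case by (auto intro!: integral_nonneg integrable_continuous_interval continuous_intros)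
next
  case (insert n A)
  define c where "c = fourier_coeff g n"
  define e where "e = (\<lambda>x::real. c * cis (2 * pi * of_int n * x))"
  have cont_e: "continuous_on {0..1} e" unfolding e_def by (intro continuous_intros)
  note cont = insert.prems cont_e
  have "(\<Sum>m\<in>A. (norm (fourier_coeff g m))\<^sup>2) = (\<Sum>m\<in>A. (norm (fourier_coeff (\<lambda>x. g x - e x) m))\<^sup>2)"
    using insert.hyps cont by (intro sum.cong) (auto simp: fourier_coeff_diff fourier_coeff_cis e_def)
  also have "\<dots> \<le> integral {0..1} (\<lambda>x. (norm (g x - e x))\<^sup>2)"
    by (intro insert.IH continuous_intros cont)
  also have "\<dots> = integral {0..1} (\<lambda>x. (norm (g x))\<^sup>2) - (norm c)\<^sup>2"
  proof -
    have "(norm (g x - e x))\<^sup>2 = (norm (g x))\<^sup>2 + (norm c)\<^sup>2 -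
        2 * Re (cnj c * (cis (- 2 * pi * of_int n * x) * g x))" for x
    proof -
      have "(norm (g x - e x))\<^sup>2 = (norm (g x))\<^sup>2 + (norm (e x))\<^sup>2 - 2 * Re (cnj (e x) * g x)"
        unfolding cmod_power2 by (simp add: power2_eq_square algebra_simps)
      then show ?thesis by (simp add: e_def norm_mult cis_cnj mult_ac)
    qed
    then have "integral {0..1} (\<lambda>x. (norm (g x - e x))\<^sup>2) =
        integral {0..1} (\<lambda>x. (norm (g x))\<^sup>2 + (norm c)\<^sup>2) - integral {0..1} (\<lambda>x.
        2 * Re (cnj c * (cis (- 2 * pi * of_int n * x) * g x)))"
      by (simp only:) (intro integral_diff integrable_continuous_interval continuous_intros cont)
    also have "integral {0..1} (\<lambda>x. (norm (g x))\<^sup>2 + (norm c)\<^sup>2) =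
        integral {0..1} (\<lambda>x. (norm (g x))\<^sup>2) + (norm c)\<^sup>2"
      by (subst integral_add) (auto intro!: integrable_continuous_interval continuous_intros cont)
    also have "integral {0..1} (\<lambda>x. 2 * Re (cnj c * (cis (- 2 * pi * of_int n * x) * g x))) =
       Re (integral {0..1} (\<lambda>x. 2 * (cnj c * (cis (- 2 * pi * of_int n * x) * g x))))"
    proof -
      have "(\<lambda>x. 2 * (cnj c * (cis (- 2 * pi * of_int n * x) * g x))) integrable_on {0..1}"
        by (intro integrable_continuous_interval continuous_intros cont)
      from integral_linear[OF this bounded_linear_Re] show ?thesis by (simp add: o_def)
    qed
    also have "\<dots> = Re (2 * (cnj c * c))"
      unfolding integral_mult_right by (simp only: c_def fourier_coeff_def)
    also have "\<dots> = 2 * (norm c)\<^sup>2" unfolding cmod_power2 by (simp add: power2_eq_square)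
    finally show ?thesis by simp
  qed
  finally show ?case using insert.hyps by (simp add: c_def)
qed

text \<open>Chernoff's argument: dividing \<open>f - f x0\<close> by a function with a simple zero at \<open>x0\<close> makes the
  Fourier coefficients telescope, and those of the quotient tend to 0.\<close>

lemma fourier_coeff_eq_0_imp_eq_0:
  assumes hol: "T holomorphic_on UNIV" and x0: "0 < x0" "x0 < 1"
    and zero: "\<And>n. fourier_coeff (\<lambda>x. T (of_real x)) n = 0"
  shows "T (of_real x0) = 0"
proof -
  define d where "d = (\<lambda>z::complex. exp (2 * of_real pi * \<i> * (z - of_real x0)) - 1)"
  define T' where "T' = deriv T (of_real x0)"
  \<comment> \<open>The value at \<open>x0\<close> is the limit of the quotient, which makes
    \<open>g\<close> continuous on the whole interval; \<open>d\<close> has no other zero there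
    because \<open>x0\<close> is an interior point.\<close>
  define g where "g = (\<lambda>z. if z = of_real x0 then T' / (2 * of_real pi * \<i>) else (T z - T (of_real x0)) / d z)"
  have d_real: "d (of_real x) = cis (2 * pi * (x - x0)) - 1" for x
    by (simp add: d_def cis_conv_exp mult_ac)
  have d0: "d (of_real x) \<noteq> 0" if "x \<in> {0..1}" "x \<noteq> x0" for x
  proof
    assume "d (of_real x) = 0"
    then obtain k :: int where "2 * pi * (x - x0) = of_int (2 * k) * pi"
      by (auto simp: d_def exp_eq_1)
    then have "x - x0 = of_int k" by simp
    moreover have "\<bar>x - x0\<bar> < 1" using that x0 by auto
    ultimately have "k = 0" by linarith
    then show False using that \<open>x - x0 = of_int k\<close> by simp
  qed
  have fg: "T (of_real x) - T (of_real x0) = g (of_real x) * d (of_real x)" if "x \<in> {0..1}" for x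
    using d0[OF that] by (auto simp: g_def d_def)
  have isCont_T: "isCont T z" for z
    using holomorphic_on_imp_continuous_on[OF hol] by (simp add: continuous_on_eq_continuous_at)
  have isCont_g: "isCont g (of_real x)" if x: "x \<in> {0..1}" for x
  proof (cases "x = x0")
    case False
    have "isCont (\<lambda>z. (T z - T (of_real x0)) / d z) (of_real x)"
      using d0[OF x False] unfolding d_def by (intro continuous_intros isCont_T) auto
    moreover have "eventually (\<lambda>z. z \<noteq> of_real x0) (nhds (of_real x :: complex))"
      using False by (intro t1_space_nhds) auto
    then have "eventually (\<lambda>z. g z = (T z - T (of_real x0)) / d z) (nhds (of_real x))"
      by eventually_elim (simp add: g_def)
    ultimately show ?thesis by (subst isCont_cong)
  next
    case True
    have 1: "(\<lambda>z. (T z - T (of_real x0)) / (z - of_real x0)) \<midarrow>of_real x0\<rightarrow> T'"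
      using holomorphic_derivI[OF hol, of "of_real x0"] unfolding T'_def
      by (simp add: has_field_derivative_iff)
    have "(d has_field_derivative 2 * of_real pi * \<i>) (at (of_real x0))"
      unfolding d_def by (auto intro!: derivative_eq_intros)
    then have 2: "(\<lambda>z. d z / (z - of_real x0)) \<midarrow>of_real x0\<rightarrow> 2 * of_real pi * \<i>"
      unfolding has_field_derivative_iff by (simp add: d_def)
    have "(\<lambda>z. (T z - T (of_real x0)) / (z - of_real x0) / (d z / (z - of_real x0)))
        \<midarrow>of_real x0\<rightarrow> T' / (2 * of_real pi * \<i>)"
      by (intro tendsto_divide 1 2) auto
    moreover have "eventually (\<lambda>z. g z =
        (T z - T (of_real x0)) / (z - of_real x0) / (d z / (z - of_real x0))) (at (of_real x0))"
      by (auto simp: g_def eventually_at_filter)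
    ultimately have "g \<midarrow>of_real x0\<rightarrow> T' / (2 * of_real pi * \<i>)"
      by (subst tendsto_cong)
    then show ?thesis by (simp add: isCont_def True g_def)
  qed
  have cont_g: "continuous_on {0..1} (\<lambda>x::real. g (of_real x))"
    by (intro continuous_at_imp_continuous_on ballI isCont_o2[where g=g and f=of_real] isCont_g)
       (auto intro!: continuous_intros)
  define a where "a = fourier_coeff (\<lambda>x. g (of_real x))"
  define b where "b = (\<lambda>n::int. cis (2 * pi * of_int n * x0) * a n)"
  have norm_b: "norm (b n) = norm (a n)" for n by (simp add: b_def norm_mult)
  \<comment> \<open>Multiplication by \<open>d\<close> shifts the index, and the phase in
    \<open>b\<close> turns this into a difference of consecutive terms. All coefficients of
    \<open>T\<close> vanish, so only the constant \<open>T (of_real x0)\<close> contributes, at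
    index 0.\<close>
  have tel: "b (n - 1) - b n = (if n = 0 then - T (of_real x0) else 0)" for n
  proof -
    have "b (n - 1) - b n = cis (2 * pi * of_int n * x0) *
        (cis (- 2 * pi * x0) * a (n - 1) - a n)"
    proof -
      have "cis (2 * pi * of_int (n - 1) * x0) = cis (2 * pi * of_int n * x0) * cis (- 2 * pi * x0)"
        by (simp add: cis_mult algebra_simps)
      then show ?thesis by (simp add: b_def algebra_simps)
    qed
    also have "cis (- 2 * pi * x0) * a (n - 1) - a n =
        integral {0..1} (\<lambda>x. cis (- 2 * pi * x0) * (cis (- 2 * pi * of_int (n - 1) * x) * g (of_real x))
           - cis (- 2 * pi * of_int n * x) * g (of_real x))"
      unfolding a_def fourier_coeff_def
      by (subst integral_diff) (auto intro!: integrable_continuous_interval continuous_intros cont_g)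
    also have "\<dots> = integral {0..1} (\<lambda>x. cis (- 2 * pi * of_int n * x) *
         (T (of_real x) - T (of_real x0)))"
    proof (intro integral_cong)
      fix x :: real assume x: "x \<in> {0..1}"
      have "cis (- 2 * pi * x0) * cis (- 2 * pi * of_int (n - 1) * x) =
          cis (- 2 * pi * of_int n * x) * cis (2 * pi * (x - x0))"
        by (simp add: cis_mult algebra_simps)
      then show "cis (- 2 * pi * x0) * (cis (- 2 * pi * of_int (n - 1) * x) * g (of_real x))
           - cis (- 2 * pi * of_int n * x) * g (of_real x) =
          cis (- 2 * pi * of_int n * x) * (T (of_real x) - T (of_real x0))"
        unfolding fg[OF x] d_real by (simp add: right_diff_distrib left_diff_distrib mult_ac)
    qed
    also have "\<dots> = fourier_coeff (\<lambda>x. T (of_real x) - T (of_real x0) * cis (2 * pi * of_int 0 * x)) n"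
      by (simp add: fourier_coeff_def)
    also have "\<dots> = (if n = 0 then - T (of_real x0) else 0)"
    proof (subst fourier_coeff_diff)
      show "continuous_on {0..1} (\<lambda>x. T (of_real x))"
        by (intro continuous_on_compose2[OF holomorphic_on_imp_continuous_on[OF hol]]
            continuous_intros) auto
    qed (simp_all only: zero fourier_coeff_cis, auto intro!: continuous_intros)
    finally show ?thesis by auto
  qed
  \<comment> \<open>Bessel's inequality bounds the sum of squares, so coefficients of constant norm
    along infinitely many indices are zero. By \<open>tel\<close> this applies separately to n >= 0
    and to n <= -1, and the jump between the two ranges is \<open>T (of_real x0)\<close>.\<close>
  have small: "c = 0" if "\<And>n. norm (a (\<sigma> n)) = c" "inj \<sigma>" for \<sigma> :: "nat \<Rightarrow> int" and c
  proof (rule ccontr)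
    assume "c \<noteq> 0"
    define I where "I = integral {0..1} (\<lambda>x. (norm (g (of_real x)))\<^sup>2)"
    have le: "of_nat N * c\<^sup>2 \<le> I" for N
    proof -
      have "(\<Sum>n\<in>\<sigma> ` {..<N}. (norm (a n))\<^sup>2) \<le> I"
        unfolding a_def I_def by (intro bessel_inequality cont_g) auto
      also have "(\<Sum>n\<in>\<sigma> ` {..<N}. (norm (a n))\<^sup>2) = of_nat N * c\<^sup>2"
        using that by (subst sum.reindex) (auto intro: inj_on_subset[OF that(2)])
      finally show ?thesis .
    qed
    obtain N where "I < of_nat N * c\<^sup>2"
      using reals_Archimedean3[of "c\<^sup>2"] \<open>c \<noteq> 0\<close> by auto
    with le[of N] show False by simp
  qed
  have "norm (b (int n)) = norm (b 0)" for n
  proof (induction n)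
    case (Suc n) then show ?case using tel[of "int (Suc n)"] by simp
  qed simp
  from small[of int, OF this[unfolded norm_b]] have 1: "b 0 = 0" by (simp add: b_def)
  have "norm (b (- 1 - int n)) = norm (b (- 1))" for n
  proof (induction n)
    case (Suc n) then show ?case using tel[of "- 1 - int n"] by (simp add: algebra_simps)
  qed simp
  from small[of "\<lambda>n. - 1 - int n", OF this[unfolded norm_b]] have "b (- 1) = 0"
    by (simp add: b_def inj_def)
  then show ?thesis using tel[of 0] 1 by simp
qed

section \<open>Holomorphic series, Gaussian sums and termwise integration\<close>

text \<open>Locally uniform convergence, by the M-test on discs inside \<open>S\<close>. The index
  set is arbitrary because theta series are sums over pairs of integers without a preferred
  order.\<close>

lemma holomorphic_on_infsum:
  fixes f :: "'i \<Rightarrow> complex \<Rightarrow> complex"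
  assumes hol: "\<And>i. i \<in> I \<Longrightarrow> f i holomorphic_on S"
    and bound: "\<And>z. z \<in> S \<Longrightarrow> \<exists>r>0. \<exists>M. cball z r \<subseteq> S \<and> M summable_on I \<and>
      (\<forall>i\<in>I. \<forall>w\<in>cball z r. norm (f i w) \<le> M i)"
  shows "(\<lambda>z. \<Sum>\<^sub>\<infinity>i\<in>I. f i z) holomorphic_on S"
proof -
  have "(\<lambda>z. \<Sum>\<^sub>\<infinity>i\<in>I. f i z) field_differentiable at z within S" if z: "z \<in> S" for z
  proof -
    obtain r M where r: "r > 0" "cball z r \<subseteq> S" "M summable_on I"
      and M: "\<And>i w. i \<in> I \<Longrightarrow> w \<in> cball z r \<Longrightarrow> norm (f i w) \<le> M i"
      using bound[OF z] by blast
    have lim: "uniform_limit (cball z r) (\<lambda>X z. \<Sum>i\<in>X. f i z) (\<lambda>z. \<Sum>\<^sub>\<infinity>i\<in>I. f i z) (finite_subsets_at_top I)"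
      using M r(3) by (rule Weierstrass_m_test_general)
    have hol': "(\<lambda>z. \<Sum>i\<in>X. f i z) holomorphic_on cball z r" if "X \<subseteq> I" for X
      using that r(2) by (intro holomorphic_intros) (auto intro: holomorphic_on_subset[OF hol])
    have "eventually (\<lambda>X. continuous_on (cball z r) (\<lambda>z. \<Sum>i\<in>X. f i z) \<and>
        (\<lambda>z. \<Sum>i\<in>X. f i z) holomorphic_on ball z r) (finite_subsets_at_top I)"
      using hol' ball_subset_cball
      by (intro eventually_finite_subsets_at_top_weakI)
         (blast intro: holomorphic_on_imp_continuous_on holomorphic_on_subset)
    then have "(\<lambda>z. \<Sum>\<^sub>\<infinity>i\<in>I. f i z) holomorphic_on ball z r"
      using holomorphic_uniform_limit[OF _ lim] by auto
    then have "(\<lambda>z. \<Sum>\<^sub>\<infinity>i\<in>I. f i z) field_differentiable at z"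
      using r(1) by (auto simp: holomorphic_on_open field_differentiable_def)
    then show ?thesis by (rule field_differentiable_at_within)
  qed
  then show ?thesis by (simp add: holomorphic_on_def)
qed

lemma summable_on_gaussian_int:
  assumes "s > 0"
  shows "(\<lambda>n::int. exp (- s * (of_int n)\<^sup>2) :: real) summable_on UNIV"
proof (rule summable_on_comparison_test)
  have "summable (\<lambda>n. exp (- s) ^ n)"
    using assms by (intro summable_geometric) auto
  then have 1: "(\<lambda>n::nat. exp (- s) ^ n) summable_on UNIV"
    by (subst summable_on_UNIV_nonneg_real_iff) auto
  have "(\<lambda>n. exp (- s) ^ nat \<bar>n\<bar>) summable_on (range int)"
    by (subst summable_on_reindex) (auto simp: o_def 1)
  moreover have "(\<lambda>n. exp (- s) ^ nat \<bar>n\<bar>) summable_on (range (\<lambda>n. - int n))"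
    by (subst summable_on_reindex) (auto simp: o_def 1 inj_def)
  moreover have "(UNIV :: int set) = range int \<union> range (\<lambda>n. - int n)"
  proof (intro equalityI subsetI)
    fix n :: int show "n \<in> range int \<union> range (\<lambda>n. - int n)" by (cases n rule: int_cases2) auto
  qed auto
  ultimately show "(\<lambda>n. exp (- s) ^ nat \<bar>n\<bar>) summable_on (UNIV :: int set)"
    using summable_on_union by metis
  fix n :: int
  have "\<bar>n\<bar> \<le> n\<^sup>2" using abs_square_le_1[of n] self_le_power[of "\<bar>n\<bar>" 2] by (cases "n = 0") auto
  then have "(of_int \<bar>n\<bar> :: real) \<le> of_int (n\<^sup>2)" by linarith
  then have "real (nat \<bar>n\<bar>) \<le> (of_int n)\<^sup>2" by simp
  then have "s * real (nat \<bar>n\<bar>) \<le> s * (of_int n)\<^sup>2" using assms by simp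
  then show "exp (- s * (of_int n)\<^sup>2) \<le> exp (- s) ^ nat \<bar>n\<bar>"
    by (simp add: exp_of_nat_mult[symmetric] mult.commute)
qed auto

lemma summable_on_gaussian_shift:
  assumes "s > 0"
  shows "(\<lambda>n::int. exp (- s * (of_int n + h)\<^sup>2) :: real) summable_on UNIV"
proof (rule summable_on_comparison_test)
  show "(\<lambda>n::int. exp (s * h\<^sup>2) * exp (- (s / 2) * (of_int n)\<^sup>2) :: real) summable_on UNIV"
    using assms by (intro summable_on_cmult_right summable_on_gaussian_int) auto
  fix n :: int
  have "(of_int n)\<^sup>2 \<le> 2 * (of_int n + h)\<^sup>2 + 2 * h\<^sup>2"
    using zero_le_power2[of "of_int n + 2 * h"] by (simp add: power2_eq_square algebra_simps)
  then have "s * (of_int n)\<^sup>2 \<le> s * (2 * (of_int n + h)\<^sup>2 + 2 * h\<^sup>2)" using assms by simp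
  then show "exp (- s * (of_int n + h)\<^sup>2) \<le> exp (s * h\<^sup>2) * exp (- (s / 2) * (of_int n)\<^sup>2)"
    by (simp add: algebra_simps flip: exp_add)
qed auto

lemma has_sum_integral:
  fixes f :: "'i \<Rightarrow> real \<Rightarrow> complex"
  assumes cont: "\<And>i. i \<in> I \<Longrightarrow> continuous_on {a..b} (f i)"
    and M: "\<And>i x. i \<in> I \<Longrightarrow> x \<in> {a..b} \<Longrightarrow> norm (f i x) \<le> M i" "M summable_on I"
  shows "((\<lambda>i. integral {a..b} (f i)) has_sum integral {a..b} (\<lambda>x. \<Sum>\<^sub>\<infinity>i\<in>I. f i x)) I"
proof -
  \<comment> \<open>Extending by zero outside \<open>I\<close> makes every finite partial sum
    continuous, also over finite sets not contained in \<open>I\<close>.\<close>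
  define f' where "f' = (\<lambda>i. if i \<in> I then f i else (\<lambda>_. 0))"
  have cont': "continuous_on {a..b} (f' i)" for i using cont by (simp add: f'_def)
  have "uniform_limit {a..b} (\<lambda>X z. \<Sum>i\<in>X. f' i z) (\<lambda>z. \<Sum>\<^sub>\<infinity>i\<in>I. f' i z) (finite_subsets_at_top I)"
    using M by (intro Weierstrass_m_test_general[where M=M]) (auto simp: f'_def)
  then obtain J K where J: "\<And>X. ((\<lambda>z. \<Sum>i\<in>X. f' i z) has_integral J X) {a..b}"
    and K: "((\<lambda>z. \<Sum>\<^sub>\<infinity>i\<in>I. f' i z) has_integral K) {a..b}" "(J \<longlongrightarrow> K) (finite_subsets_at_top I)"
    by (rule uniform_limit_integral) (auto intro!: continuous_intros cont')
  have "J X = (\<Sum>i\<in>X. integral {a..b} (f' i))" for X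
    using J[of X, THEN integral_unique] cont'
    by (cases "finite X") (auto simp: integral_sum integrable_continuous_interval)
  then have "((\<lambda>X. \<Sum>i\<in>X. integral {a..b} (f' i)) \<longlongrightarrow> K) (finite_subsets_at_top I)"
    using K(2) by (metis (no_types, lifting) ext)
  then have "((\<lambda>i. integral {a..b} (f' i)) has_sum K) I" by (simp add: has_sum_def)
  moreover have "K = integral {a..b} (\<lambda>x. \<Sum>\<^sub>\<infinity>i\<in>I. f i x)"
    using K(1)[THEN integral_unique] by (simp add: f'_def cong: infsum_cong)
  ultimately have "((\<lambda>i. integral {a..b} (f' i)) has_sum integral {a..b} (\<lambda>x. \<Sum>\<^sub>\<infinity>i\<in>I. f i x)) I"
    by simp
  then show ?thesis by (rule has_sum_cong[THEN iffD1, rotated]) (simp add: f'_def)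
qed

section \<open>Poisson summation for Gaussians in one variable\<close>

text \<open>A rescaling of the characteristic function of the standard normal distribution:
  \<open>c\<close> is chosen so that (c x)^2 / 2 = pi s x^2, and \<open>t\<close> so that t c = 2 pi
  \<eta>.\<close>

lemma gaussian_fourier_transform:
  assumes "s > 0"
  shows "((\<lambda>x. exp (of_real (- pi * s * x\<^sup>2) + 2 * of_real pi * \<i> * of_real (\<eta> * x))) has_integral
    complex_of_real (exp (- pi * \<eta>\<^sup>2 / s) / sqrt s)) UNIV"
proof -
  define c where "c = sqrt (2 * pi * s)"
  define t where "t = 2 * pi * \<eta> / c"
  define f where "f = (\<lambda>x. std_normal_density x *\<^sub>R iexp (t * x))"
  have c: "c > 0" "c\<^sup>2 = 2 * pi * s" using assms by (auto simp: c_def)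
  have "complex_of_real (exp (- t\<^sup>2 / 2)) = (LINT x|std_normal_distribution. iexp (t * x))"
    using fun_cong[OF char_std_normal_distribution, of t] by (simp add: char_def)
  also have "\<dots> = integral\<^sup>L lborel f"
    unfolding f_def by (subst integral_density) auto
  also have "\<dots> = \<bar>c\<bar> *\<^sub>R (LINT x|lborel. f (0 + c * x))"
    using c by (intro lborel_integral_real_affine) auto
  finally have val: "(LINT x|lborel. f (c * x)) = of_real (exp (- t\<^sup>2 / 2) / c)"
    using c by (simp add: scaleR_conv_of_real field_simps)
  have "integrable lborel f"
  proof (rule Bochner_Integration.integrable_bound)
    show "integrable lborel std_normal_density" by (rule integrable_normal_density) simp
  qed (auto simp: f_def)
  then have "integrable lborel (\<lambda>x. f (0 + c * x))"
    using c by (subst lborel_integrable_real_affine_iff) auto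
  then have "((\<lambda>x. f (c * x)) has_integral of_real (exp (- t\<^sup>2 / 2) / c)) UNIV"
    using has_integral_integral_lborel[of "\<lambda>x. f (c * x)"] val by simp
  then have "((\<lambda>x. of_real (sqrt (2 * pi)) * f (c * x)) has_integral
      of_real (sqrt (2 * pi)) * of_real (exp (- t\<^sup>2 / 2) / c)) UNIV"
    by (rule has_integral_mult_right)
  moreover have "of_real (sqrt (2 * pi)) * f (c * x) =
      exp (of_real (- pi * s * x\<^sup>2) + 2 * of_real pi * \<i> * of_real (\<eta> * x))" for x
  proof -
    have 1: "(c * x)\<^sup>2 / 2 = pi * s * x\<^sup>2" using c by (simp add: power_mult_distrib)
    have 2: "t * (c * x) = 2 * pi * (\<eta> * x)" using c by (simp add: t_def)
    have "of_real (sqrt (2 * pi)) * f (c * x) = of_real (exp (- ((c * x)\<^sup>2 / 2))) * iexp (t * (c * x))"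
      by (simp add: f_def std_normal_density_def scaleR_conv_of_real)
    also have "\<dots> = exp (of_real (- pi * s * x\<^sup>2) + 2 * of_real pi * \<i> * of_real (\<eta> * x))"
      unfolding 1 2 exp_add by (simp add: exp_of_real[symmetric] mult_ac)
    finally show ?thesis .
  qed
  moreover have "sqrt (2 * pi) * (exp (- t\<^sup>2 / 2) / c) = exp (- pi * \<eta>\<^sup>2 / s) / sqrt s"
  proof -
    have "t\<^sup>2 / 2 = pi * \<eta>\<^sup>2 / s"
      unfolding t_def power_divide c(2) using assms by (simp add: field_simps power2_eq_square)
    then show ?thesis using assms by (simp add: c_def real_sqrt_mult)
  qed
  moreover have "of_real (sqrt (2 * pi)) * of_real (exp (- t\<^sup>2 / 2) / c) =
      complex_of_real (exp (- pi * \<eta>\<^sup>2 / s) / sqrt s)"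
    unfolding of_real_mult[symmetric] using calculation(3) by (rule arg_cong)
  ultimately show ?thesis by (simp only:)
qed

text \<open>The unfolding step of Poisson summation. Both numbers are limits of the integrals over
  the intervals from -N to N: \<open>S\<close> because the index sets
  \<open>{- int N..<int N}\<close> exhaust the integers, \<open>J\<close> by the definition of the
  gauge integral over the line.\<close>

lemma has_sum_integral_unit_intervals:
  fixes f :: "real \<Rightarrow> complex"
  assumes cont: "continuous_on UNIV f" and J: "(f has_integral J) UNIV"
    and S: "((\<lambda>m::int. integral {of_int m..of_int m + 1} f) has_sum S) UNIV"
  shows "S = J"
proof -
  have int: "f integrable_on {a..b}" for a b
    by (intro integrable_continuous_interval continuous_on_subset[OF cont]) auto
  have part: "(\<Sum>m\<in>{- int N..<int N}. integral {of_int m..of_int m + 1} f) =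
      integral {- real N..real N} f" for N
  proof (induction N)
    case (Suc N)
    have "{- int (Suc N)..<int (Suc N)} = insert (- int (Suc N)) (insert (int N) {- int N..<int N})"
      by auto
    then have "(\<Sum>m\<in>{- int (Suc N)..<int (Suc N)}. integral {of_int m..of_int m + 1} f) =
        integral {- real (Suc N)..- real N} f + (integral {- real N..real N} f +
        integral {real N..real (Suc N)} f)"
      unfolding Suc[symmetric] by (simp add: add.commute[of 1])
    also have "\<dots> = integral {- real (Suc N)..real (Suc N)} f"
      using Henstock_Kurzweil_Integration.integral_combine[of "- real N" "real N" "real (Suc N)" f]
        Henstock_Kurzweil_Integration.integral_combine[of "- real (Suc N)" "- real N" "real (Suc N)" f] int
      by simp
    finally show ?case .
  qed simp
  have "filterlim (\<lambda>N. {- int N..<int N}) (finite_subsets_at_top UNIV) sequentially"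
    unfolding filterlim_finite_subsets_at_top
  proof (intro allI impI)
    fix X :: "int set" assume "finite X \<and> X \<subseteq> UNIV"
    then obtain B where B: "\<And>x. x \<in> X \<Longrightarrow> \<bar>x\<bar> \<le> B"
      by (meson Max_ge finite_imageI imageI)
    show "\<forall>\<^sub>F N in sequentially. finite {- int N..<int N} \<and> X \<subseteq> {- int N..<int N} \<and> {- int N..<int N} \<subseteq> UNIV"
      using eventually_gt_at_top[of "nat B"]
    proof eventually_elim
      case (elim N)
      have "x \<in> {- int N..<int N}" if "x \<in> X" for x using B[OF that] elim by auto
      then show ?case by auto
    qed
  qed
  with S have "(\<lambda>N. \<Sum>m\<in>{- int N..<int N}. integral {of_int m..of_int m + 1} f) \<longlonglongrightarrow> S"
    unfolding has_sum_def by (rule filterlim_compose)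
  then have "(\<lambda>N. integral {- real N..real N} f) \<longlonglongrightarrow> S" by (simp only: part)
  moreover have "(\<lambda>N. integral {- real N..real N} f) \<longlonglongrightarrow> J"
  proof (rule tendstoI)
    fix e :: real assume "e > 0"
    then obtain B where "B > 0" and B: "\<And>a b. ball 0 B \<subseteq> cbox a b \<Longrightarrow>
        \<exists>z. ((\<lambda>x. if x \<in> UNIV then f x else 0) has_integral z) (cbox a b) \<and> norm (z - J) < e"
      using J[THEN has_integral'[THEN iffD1], rule_format, of e] by blast
    show "\<forall>\<^sub>F N in sequentially. dist (integral {- real N..real N} f) J < e"
      using eventually_gt_at_top[of "nat \<lceil>B\<rceil>"]
    proof eventually_elim
      case (elim N)
      then have "ball 0 B \<subseteq> cbox (- real N) (real N)"
        by (intro subsetI) (simp add: dist_norm abs_if split: if_splits, linarith+)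
      from B[OF this] show ?case by (auto simp: dist_norm dest!: integral_unique)
    qed
  qed
  ultimately show ?thesis by (rule LIMSEQ_unique)
qed

text \<open>Both sides extend to entire functions \<open>F\<close> and \<open>G\<close> of the shift
  \<open>h\<close>, with equal Fourier coefficients on the unit interval. Chernoff's argument gives
  equality on the open interval, and the identity theorem gives it for every \<open>h\<close>. The
  twist by \<open>\<xi>\<close> allows the formula to be applied twice in the case of two
  variables.\<close>

theorem poisson_summation_gaussian:
  assumes s: "s > 0"
  shows "(\<Sum>\<^sub>\<infinity>n::int. exp (- of_real (pi * s) * (of_int n + of_real h)\<^sup>2 +
       2 * of_real pi * \<i> * of_real \<xi> * (of_int n + of_real h))) =
    (\<Sum>\<^sub>\<infinity>l::int. exp (- of_real (pi / s) * (of_int l - of_real \<xi>)\<^sup>2 + 2 * of_real pi * \<i> * of_int l * of_real h)) /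
     complex_of_real (sqrt s)"
proof -
  define f where "f = (\<lambda>(n::int) z. exp (- of_real (pi * s) * (of_int n + z)\<^sup>2 +
       2 * of_real pi * \<i> * of_real \<xi> * (of_int n + z)))"
  define c where "c = (\<lambda>l::int. complex_of_real (exp (- (pi / s) * (of_int l - \<xi>)\<^sup>2) / sqrt s))"
  define g where "g = (\<lambda>(l::int) z. c l * exp (2 * of_real pi * \<i> * of_int l * z))"
  \<comment> \<open>Majorants valid for \<open>norm z \<le> R\<close>. Half of the Gaussian rate is
    kept in the index; the other half pays for the shift by \<open>z\<close> in \<open>f\<close> and
    for the growth of the exponential in \<open>g\<close>.\<close>
  define Mf where "Mf = (\<lambda>R (n::int). exp (pi * s * R\<^sup>2 + 2 * pi * \<bar>\<xi>\<bar> * R) * exp (- (pi * s / 2) * (of_int n)\<^sup>2))"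
  define Mg where "Mg = (\<lambda>R (l::int). exp (2 * pi * s * R\<^sup>2 + 2 * pi * \<bar>\<xi>\<bar> * R) / sqrt s *
     exp (- (pi / (2 * s)) * (of_int l + (- \<xi>))\<^sup>2))"
  have sumMf: "Mf R summable_on UNIV" for R
    unfolding Mf_def using s by (intro summable_on_cmult_right summable_on_gaussian_int) auto
  have sumMg: "Mg R summable_on UNIV" for R
    unfolding Mg_def using s by (intro summable_on_cmult_right summable_on_gaussian_shift) auto
  have Mf: "norm (f n z) \<le> Mf R n" if R: "norm z \<le> R" for n z R
  proof -
    have R': "(Re z)\<^sup>2 + (Im z)\<^sup>2 \<le> R\<^sup>2" "\<bar>Im z\<bar> \<le> R"
      using R abs_Im_le_cmod[of z] power_mono[OF R, of 2] by (auto simp: cmod_power2)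
    have "(of_int n)\<^sup>2 \<le> 2 * (of_int n + Re z)\<^sup>2 + 2 * (Re z)\<^sup>2"
      using zero_le_power2[of "of_int n + 2 * Re z"] by (simp add: power2_eq_square algebra_simps)
    then have "(of_int n)\<^sup>2 / 2 - R\<^sup>2 \<le> (of_int n + Re z)\<^sup>2 - (Im z)\<^sup>2" using R' by simp
    then have 1: "pi * s * ((of_int n)\<^sup>2 / 2 - R\<^sup>2) \<le> pi * s * ((of_int n + Re z)\<^sup>2 - (Im z)\<^sup>2)"
      using s by (intro mult_left_mono) auto
    have "- (\<xi> * Im z) \<le> \<bar>\<xi>\<bar> * R"
      using mult_left_mono[OF R'(2), of "\<bar>\<xi>\<bar>"] abs_le_D2[of "\<xi> * Im z"] by (simp add: abs_mult)
    then have 2: "2 * pi * (- (\<xi> * Im z)) \<le> 2 * pi * (\<bar>\<xi>\<bar> * R)" by (intro mult_left_mono) auto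
    have "norm (f n z) = exp (- (pi * s * ((of_int n + Re z)\<^sup>2 - (Im z)\<^sup>2)) + 2 * pi * (- (\<xi> * Im z)))"
      by (simp add: f_def Re_power2)
    also have "\<dots> \<le> exp (- (pi * s * ((of_int n)\<^sup>2 / 2 - R\<^sup>2)) + 2 * pi * (\<bar>\<xi>\<bar> * R))"
      by (rule exp_le_cancel_iff[THEN iffD2, OF add_mono[OF le_imp_neg_le[OF 1] 2]])
    also have "\<dots> = Mf R n" by (simp add: Mf_def algebra_simps flip: exp_add)
    finally show ?thesis .
  qed
  have Mg: "norm (g l z) \<le> Mg R l" if R: "norm z \<le> R" for l z R
  proof -
    define u where "u = of_int l - \<xi>"
    have R': "(Im z)\<^sup>2 \<le> R\<^sup>2" "\<bar>Im z\<bar> \<le> R"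
      using R abs_Im_le_cmod[of z] power_mono[of "\<bar>Im z\<bar>" R 2] by auto
    have "(pi / (2 * s)) * (u + 2 * s * Im z)\<^sup>2 \<ge> 0" using s by simp
    also have "(pi / (2 * s)) * (u + 2 * s * Im z)\<^sup>2 =
        pi / (2 * s) * u\<^sup>2 + 2 * pi * (u * Im z) + 2 * pi * s * (Im z)\<^sup>2"
      using s by (simp add: power2_eq_square field_simps)
    also have "2 * pi * s * (Im z)\<^sup>2 \<le> 2 * pi * s * R\<^sup>2" using R' s by (intro mult_left_mono) auto
    finally have 1: "- (2 * pi * (u * Im z)) \<le> pi / (2 * s) * u\<^sup>2 + 2 * pi * s * R\<^sup>2" by simp
    have "- (\<xi> * Im z) \<le> \<bar>\<xi>\<bar> * R"
      using mult_left_mono[OF R'(2), of "\<bar>\<xi>\<bar>"] abs_le_D2[of "\<xi> * Im z"] by (simp add: abs_mult)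
    then have 2: "2 * pi * (- (\<xi> * Im z)) \<le> 2 * pi * (\<bar>\<xi>\<bar> * R)" by (intro mult_left_mono) auto
    have "norm (g l z) = exp (- (pi / s) * u\<^sup>2) / sqrt s * exp (- (2 * pi * of_int l * Im z))"
      using s by (simp add: g_def c_def norm_mult norm_divide u_def)
    also have "\<dots> = exp (- (pi / s) * u\<^sup>2 - 2 * pi * (u * Im z) + 2 * pi * (- (\<xi> * Im z))) / sqrt s"
      by (simp add: u_def algebra_simps flip: exp_add)
    also have "\<dots> \<le> exp (2 * pi * s * R\<^sup>2 + 2 * pi * \<bar>\<xi>\<bar> * R - (pi / (2 * s)) * u\<^sup>2) / sqrt s"
    proof -
      have "pi / s = pi / (2 * s) + pi / (2 * s)" using s by simp
      then show ?thesis using 1 2 s by (intro divide_right_mono) (auto simp: algebra_simps)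
    qed
    also have "\<dots> = Mg R l" by (simp add: Mg_def u_def algebra_simps flip: exp_add)
    finally show ?thesis .
  qed
  have near: "norm w \<le> norm z + 1" if "w \<in> cball z 1" for w z :: complex
    using that norm_triangle_ineq2[of w z] by (auto simp: dist_norm norm_minus_commute)
  define F where "F = (\<lambda>z. \<Sum>\<^sub>\<infinity>n. f n z)"
  define G where "G = (\<lambda>z. \<Sum>\<^sub>\<infinity>l. g l z)"
  have holF: "F holomorphic_on UNIV"
    unfolding F_def
  proof (rule holomorphic_on_infsum)
    show "f n holomorphic_on UNIV" for n unfolding f_def by (intro holomorphic_intros)
    show "\<exists>r>0. \<exists>M. cball z r \<subseteq> UNIV \<and> M summable_on UNIV \<and>
        (\<forall>n\<in>UNIV. \<forall>w\<in>cball z r. norm (f n w) \<le> M n)" for z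
      by (rule exI[of _ 1], simp, rule exI[of _ "Mf (norm z + 1)"]) (use near Mf sumMf in auto)
  qed
  have holG: "G holomorphic_on UNIV"
    unfolding G_def
  proof (rule holomorphic_on_infsum)
    show "g l holomorphic_on UNIV" for l unfolding g_def by (intro holomorphic_intros)
    show "\<exists>r>0. \<exists>M. cball z r \<subseteq> UNIV \<and> M summable_on UNIV \<and>
        (\<forall>l\<in>UNIV. \<forall>w\<in>cball z r. norm (g l w) \<le> M l)" for z
      by (rule exI[of _ 1], simp, rule exI[of _ "Mg (norm z + 1)"]) (use near Mg sumMg in auto)
  qed
  have contf: "continuous_on A (\<lambda>x::real. cis (b * x) * f n (of_real x))" for A b n
    unfolding f_def by (intro continuous_intros)
  have contg: "continuous_on A (\<lambda>x::real. cis (b * x) * g n (of_real x))" for A b n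
    unfolding g_def by (intro continuous_intros)
  have coeff_G: "fourier_coeff (\<lambda>x. G (of_real x)) n = c n" for n
  proof -
    have "((\<lambda>l. integral {0..1} (\<lambda>x. cis (- 2 * pi * of_int n * x) * g l (of_real x))) has_sum
        integral {0..1} (\<lambda>x. \<Sum>\<^sub>\<infinity>l. cis (- 2 * pi * of_int n * x) * g l (of_real x))) UNIV"
      using Mg by (intro has_sum_integral[where M="Mg 1"] contg sumMg) (auto simp: norm_mult)
    also have "(\<lambda>x. \<Sum>\<^sub>\<infinity>l. cis (- 2 * pi * of_int n * x) * g l (of_real x)) =
        (\<lambda>x. cis (- 2 * pi * of_int n * x) * G (of_real x))"
      by (simp add: infsum_cmult_right' G_def)
    also have "(\<lambda>l. integral {0..1} (\<lambda>x. cis (- 2 * pi * of_int n * x) * g l (of_real x))) =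
        (\<lambda>l. if l = n then c l else 0)"
    proof
      fix l
      have gl: "g l (of_real x) = c l * cis (2 * pi * of_int l * x)" for x
        by (simp add: g_def cis_conv_exp mult_ac)
      show "integral {0..1} (\<lambda>x. cis (- 2 * pi * of_int n * x) * g l (of_real x)) = (if l = n then c l else 0)"
        unfolding gl using fourier_coeff_cis[of "c l" l n] unfolding fourier_coeff_def .
    qed
    finally have "((\<lambda>l. if l = n then c l else 0) has_sum fourier_coeff (\<lambda>x. G (of_real x)) n) UNIV"
      by (simp add: fourier_coeff_def)
    moreover have "((\<lambda>l. if l = n then c l else 0) has_sum c n) UNIV"
      using has_sum_finite_neutralI[of "{n}" UNIV "\<lambda>l. if l = n then c l else 0" "c n"] by simp
    ultimately show ?thesis by (rule has_sum_unique)
  qed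
  \<comment> \<open>An integer shift does not change the character, so the integrals of all terms
    over the unit interval are integrals of one Gaussian \<open>\<phi>\<close> over the unit
    intervals of the line.\<close>
  have coeff_F: "fourier_coeff (\<lambda>x. F (of_real x)) n = c n" for n
  proof -
    define \<phi> where "\<phi> = (\<lambda>x::real. exp (of_real (- pi * s * x\<^sup>2) + 2 * of_real pi * \<i> * of_real ((\<xi> - of_int n) * x)))"
    have cont\<phi>: "continuous_on A \<phi>" for A unfolding \<phi>_def by (intro continuous_intros)
    have "((\<lambda>m. integral {0..1} (\<lambda>x. cis (- 2 * pi * of_int n * x) * f m (of_real x))) has_sum
        integral {0..1} (\<lambda>x. \<Sum>\<^sub>\<infinity>m. cis (- 2 * pi * of_int n * x) * f m (of_real x))) UNIV"
      using Mf by (intro has_sum_integral[where M="Mf 1"] contf sumMf) (auto simp: norm_mult)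
    also have "(\<lambda>x. \<Sum>\<^sub>\<infinity>m. cis (- 2 * pi * of_int n * x) * f m (of_real x)) =
        (\<lambda>x. cis (- 2 * pi * of_int n * x) * F (of_real x))"
      by (simp add: infsum_cmult_right' F_def)
    also have "(\<lambda>m. integral {0..1} (\<lambda>x. cis (- 2 * pi * of_int n * x) * f m (of_real x))) =
        (\<lambda>m::int. integral {of_int m..of_int m + 1} \<phi>)"
    proof
      fix m :: int
      have "cis (- 2 * pi * of_int n * x) * f m (of_real x) = \<phi> (x + of_int m)" for x
      proof -
        have "cis (- 2 * pi * of_int n * x) = cis (- 2 * pi * of_int n * (x + of_int m))"
        proof -
          have "cis (- 2 * pi * of_int n * (x + of_int m)) =
              cis (- 2 * pi * of_int n * x) * cis (2 * pi * of_int (- (n * m)))"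
            unfolding cis_mult by (simp add: algebra_simps)
          then show ?thesis using cis_multiple_2pi[of "of_int (- (n * m))"] by simp
        qed
        then show ?thesis
          by (simp add: f_def \<phi>_def cis_conv_exp algebra_simps flip: exp_add)
      qed
      then show "integral {0..1} (\<lambda>x. cis (- 2 * pi * of_int n * x) * f m (of_real x)) =
          integral {of_int m..of_int m + 1} \<phi>"
        using integral_shift[of 0 "of_int m" 1 \<phi>] cont\<phi> by (simp add: o_def add.commute)
    qed
    finally have "fourier_coeff (\<lambda>x. F (of_real x)) n =
        complex_of_real (exp (- pi * (\<xi> - of_int n)\<^sup>2 / s) / sqrt s)"
      unfolding fourier_coeff_def
      using gaussian_fourier_transform[OF s, of "\<xi> - of_int n"] cont\<phi>
      by (intro has_sum_integral_unit_intervals[where f=\<phi>]) (auto simp: \<phi>_def)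
    then show ?thesis by (simp add: c_def power2_commute)
  qed
  have zero: "F (of_real x) - G (of_real x) = 0" if "0 < x" "x < 1" for x :: real
  proof (rule fourier_coeff_eq_0_imp_eq_0[where T="\<lambda>z. F z - G z"])
    have cont: "continuous_on {0..1} (\<lambda>x::real. F (of_real x))" "continuous_on {0..1} (\<lambda>x::real. G (of_real x))"
      by (auto intro!: continuous_on_compose2[OF holomorphic_on_imp_continuous_on[OF holF]]
          continuous_on_compose2[OF holomorphic_on_imp_continuous_on[OF holG]] continuous_intros)
    show "fourier_coeff (\<lambda>x. F (of_real x) - G (of_real x)) n = 0" for n
      unfolding fourier_coeff_diff[OF cont] coeff_F coeff_G by simp
  qed (use that holomorphic_on_diff[OF holF holG] in auto)
  have "F (of_real h) - G (of_real h) = 0"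
  proof (rule analytic_continuation[where f="\<lambda>z. F z - G z" and S=UNIV and U="of_real ` {0<..<1}" and \<xi>="of_real (1/2)"])
    have "(1/2::real) islimpt {0<..<1}" by (rule interior_limit_point) (simp add: interior_open)
    then show "complex_of_real (1/2) islimpt of_real ` {0<..<1}"
      by (rule islimpt_isCont_image)
         (simp_all only: of_real_eq_iff eventually_neq_at_within isCont_of_real continuous_ident)
    show "F z - G z = 0" if "z \<in> of_real ` {0<..<1}" for z
    proof -
      obtain x where "z = of_real x" "0 < x" "x < 1" using \<open>z \<in> _\<close> by auto
      then show ?thesis using zero[of x] by simp
    qed
  qed (use holomorphic_on_diff[OF holF holG] in \<open>simp_all add: connected_UNIV\<close>)
  moreover have "G (of_real h) = (\<Sum>\<^sub>\<infinity>l::int. exp (- of_real (pi / s) * (of_int l - of_real \<xi>)\<^sup>2 +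
      2 * of_real pi * \<i> * of_int l * of_real h)) / complex_of_real (sqrt s)"
  proof -
    have "g l (of_real h) = inverse (complex_of_real (sqrt s)) * exp (- of_real (pi / s) * (of_int l - of_real \<xi>)\<^sup>2 +
      2 * of_real pi * \<i> * of_int l * of_real h)" for l
      unfolding g_def c_def exp_add by (simp add: exp_of_real[symmetric] field_simps)
    then show ?thesis by (simp add: G_def infsum_cmult_right' divide_inverse mult.commute)
  qed
  ultimately show ?thesis by (simp add: F_def f_def)
qed

section \<open>Poisson summation for positive definite binary forms\<close>

lemma posdef_lower_bound:
  fixes A B C :: real
  assumes C: "C > 0" and disc: "4 * A * C - B\<^sup>2 > 0"
  obtains \<delta> where "\<delta> > 0" "\<And>x y. \<delta> * (x\<^sup>2 + y\<^sup>2) \<le> A * x\<^sup>2 + B * x * y + C * y\<^sup>2"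
proof -
  have "0 < 4 * A * C" using disc zero_le_power2[of B] by linarith
  then have A: "A > 0" using C by (simp add: zero_less_mult_iff)
  define \<Delta> where "\<Delta> = 4 * A * C - B\<^sup>2"
  \<comment> \<open>Determinant over trace of the symmetric matrix of the form, which is at most its
    smaller eigenvalue. With this choice
    \<open>4 * (A - \<delta>) * (C - \<delta>) - B\<^sup>2\<close> is exactly
    \<open>4 * \<delta>\<^sup>2\<close>.\<close>
  define \<delta> where "\<delta> = \<Delta> / (A + C) / 4"
  have nz: "A + C \<noteq> 0" using A C by simp
  have "4 * (x / 4) = x" for x :: real by simp
  then have "4 * \<delta> = \<Delta> / (A + C)" unfolding \<delta>_def .
  with nz have \<delta>2: "4 * \<delta> * (A + C) = \<Delta>" by simp
  have "\<delta> > 0" using A C disc by (simp add: \<delta>_def \<Delta>_def)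
  note \<delta> = this \<delta>2
  have "4 * (A + C) * (C - \<delta>) = 4 * C\<^sup>2 + B\<^sup>2"
    using \<delta>(2) by (simp add: \<Delta>_def algebra_simps power2_eq_square)
  moreover have "4 * C\<^sup>2 + B\<^sup>2 > 0" using C by (simp add: add_pos_nonneg)
  ultimately have C': "C - \<delta> > 0" using A C by (metis add_pos_pos zero_less_mult_pos zero_less_numeral mult_pos_pos)
  have d: "4 * (A - \<delta>) * (C - \<delta>) - B\<^sup>2 = 4 * \<delta>\<^sup>2"
    using \<delta>(2) by (simp add: \<Delta>_def algebra_simps power2_eq_square)
  show ?thesis
  proof (rule that[OF \<delta>(1)])
    fix x y :: real
    have "4 * (C - \<delta>) * ((A - \<delta>) * x\<^sup>2 + B * x * y + (C - \<delta>) * y\<^sup>2) =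
        (2 * (C - \<delta>) * y + B * x)\<^sup>2 + (4 * (A - \<delta>) * (C - \<delta>) - B\<^sup>2) * x\<^sup>2"
      by (simp add: algebra_simps power2_eq_square)
    also have "\<dots> \<ge> 0" unfolding d by simp
    finally have "0 \<le> (A - \<delta>) * x\<^sup>2 + B * x * y + (C - \<delta>) * y\<^sup>2"
      using C' by (simp add: zero_le_mult_iff)
    then show "\<delta> * (x\<^sup>2 + y\<^sup>2) \<le> A * x\<^sup>2 + B * x * y + C * y\<^sup>2" by (simp add: algebra_simps)
  qed
qed

lemma summable_on_product_nonneg:
  fixes f g :: "'a \<Rightarrow> real"
  assumes "f summable_on UNIV" "g summable_on UNIV" "\<And>x. f x \<ge> 0" "\<And>x. g x \<ge> 0"
  shows "(\<lambda>(x, y). f x * g y) summable_on UNIV"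
proof -
  have "(\<lambda>(x, y). f x * g y) summable_on (UNIV \<times> UNIV)"
  proof (rule summable_on_SigmaI)
    show "((\<lambda>y. case (x, y) of (x, y) \<Rightarrow> f x * g y) has_sum f x * infsum g UNIV) UNIV" for x
      using assms(2) by (auto intro!: has_sum_cmult_right)
    show "(\<lambda>x. f x * infsum g UNIV) summable_on UNIV"
      using assms(1) by (rule summable_on_cmult_left)
  qed (use assms in auto)
  then show ?thesis by simp
qed

lemma summable_on_exp_quadratic:
  fixes A B C :: real
  assumes C: "C > 0" and disc: "4 * A * C - B\<^sup>2 > 0" and t: "t > 0"
  shows "(\<lambda>(x::int, y::int). exp (- t * (A * (of_int x + h)\<^sup>2 + B * (of_int x + h) * of_int y + C * (of_int y)\<^sup>2)))
    summable_on UNIV"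
proof -
  obtain \<delta> where \<delta>: "\<delta> > 0" "\<And>x y. \<delta> * (x\<^sup>2 + y\<^sup>2) \<le> A * x\<^sup>2 + B * x * y + C * y\<^sup>2"
    using posdef_lower_bound[OF C disc] by blast
  show ?thesis
  proof (rule summable_on_comparison_test)
    show "(\<lambda>(x::int, y::int). exp (- (t * \<delta>) * (of_int x + h)\<^sup>2) * exp (- (t * \<delta>) * (of_int y + 0)\<^sup>2) :: real) summable_on UNIV"
      using t \<delta> by (intro summable_on_product_nonneg summable_on_gaussian_shift) auto
    fix z :: "int \<times> int"
    obtain x y where z: "z = (x, y)" by fastforce
    have "t * (\<delta> * ((of_int x + h)\<^sup>2 + (of_int y)\<^sup>2)) \<le> t * (A * (of_int x + h)\<^sup>2 + B * (of_int x + h) * of_int y + C * (of_int y)\<^sup>2)"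
      using t \<delta>(2) by (intro mult_left_mono) auto
    then show "(case z of (x, y) \<Rightarrow> exp (- t * (A * (of_int x + h)\<^sup>2 + B * (of_int x + h) * of_int y + C * (of_int y)\<^sup>2)))
        \<le> (case z of (x, y) \<Rightarrow> exp (- (t * \<delta>) * (of_int x + h)\<^sup>2) * exp (- (t * \<delta>) * (of_int y + 0)\<^sup>2))"
      by (simp add: z algebra_simps flip: exp_add)
  qed auto
qed

text \<open>Poisson summation in \<open>y\<close> and then in \<open>x\<close>, the sums being
  interchanged by absolute convergence. Only \<open>x\<close> carries a shift: theta series are
  later split by residue classes of the first variable alone.\<close>

theorem poisson_summation_quadratic:
  fixes A B C h t :: real
  assumes C: "C > 0" and disc: "4 * A * C - B\<^sup>2 > 0" and t: "t > 0"
  defines "\<Delta> \<equiv> 4 * A * C - B\<^sup>2"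
  shows "(\<Sum>\<^sub>\<infinity>(x::int, y::int). complex_of_real (exp (- 2 * pi * t *
      (A * (of_int x + h)\<^sup>2 + B * (of_int x + h) * of_int y + C * (of_int y)\<^sup>2)))) =
    (\<Sum>\<^sub>\<infinity>(m::int, l::int). complex_of_real (exp (- 2 * pi / (t * \<Delta>) *
      (C * (of_int m)\<^sup>2 - B * of_int m * of_int l + A * (of_int l)\<^sup>2))) * cis (2 * pi * of_int m * h)) /
     complex_of_real (t * sqrt \<Delta>)"
proof -
  \<comment> \<open>Completing the square, with u = x + h, writes twice \<open>t\<close> times the
    form as s1 (y + B u / (2 C))^2 + s2 u^2. The shift of \<open>y\<close> becomes a character in
    the dual variable \<open>l\<close>, which is the twist \<open>\<xi> l\<close> of the second
    summation.\<close>
  define s1 where "s1 = 2 * t * C"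
  define s2 where "s2 = t * \<Delta> / (2 * C)"
  define \<xi> where "\<xi> = (\<lambda>l::int. of_int l * B / (2 * C))"
  have \<Delta>: "\<Delta> > 0" using disc by (simp add: \<Delta>_def)
  have s: "s1 > 0" "s2 > 0" using C t \<Delta> by (auto simp: s1_def s2_def)
  have "0 < 4 * A * C" using disc zero_le_power2[of B] by linarith
  then have A: "A > 0" using C by (simp add: zero_less_mult_iff)
  define P where "P = (\<lambda>(x::int) (y::int). complex_of_real (exp (- 2 * pi * t *
      (A * (of_int x + h)\<^sup>2 + B * (of_int x + h) * of_int y + C * (of_int y)\<^sup>2))))"
  define R where "R = (\<lambda>(m::int) (l::int). complex_of_real (exp (- 2 * pi / (t * \<Delta>) *
      (C * (of_int m)\<^sup>2 - B * of_int m * of_int l + A * (of_int l)\<^sup>2))) * cis (2 * pi * of_int m * h))"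
  \<comment> \<open>the result of Poisson summation in \<open>y\<close> alone, after completing the square in \<open>y\<close>\<close>
  define X where "X = (\<lambda>(x::int) (l::int). complex_of_real (exp (- (pi * s2) * (of_int x + h)\<^sup>2)) *
      complex_of_real (exp (- (pi / s1) * (of_int l + 0)\<^sup>2)) * cis (2 * pi * \<xi> l * (of_int x + h)))"
  have sumP: "(\<lambda>(x, y). P x y) summable_on UNIV"
  proof (rule abs_summable_summable)
    show "(\<lambda>z. norm (case z of (x, y) \<Rightarrow> P x y)) summable_on UNIV"
      using summable_on_exp_quadratic[OF C disc, of "2 * pi * t" h] t
      by (simp add: P_def case_prod_unfold)
  qed
  have sumR: "(\<lambda>(m, l). R m l) summable_on UNIV"
  proof (rule abs_summable_summable)
    show "(\<lambda>z. norm (case z of (m, l) \<Rightarrow> R m l)) summable_on UNIV"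
      using summable_on_exp_quadratic[of A C "- B" "2 * pi / (t * \<Delta>)" 0] t disc A \<Delta>
      by (simp add: R_def case_prod_unfold norm_mult mult_ac)
  qed
  have sumX: "(\<lambda>(x, l). X x l) summable_on UNIV"
  proof (rule abs_summable_summable)
    have "(\<lambda>(x::int, l::int). exp (- (pi * s2) * (of_int x + h)\<^sup>2) * exp (- (pi / s1) * (of_int l + 0)\<^sup>2)) summable_on UNIV"
      using s by (intro summable_on_product_nonneg summable_on_gaussian_shift) auto
    then show "(\<lambda>z. norm (case z of (x, l) \<Rightarrow> X x l)) summable_on UNIV"
      by (simp add: X_def case_prod_unfold norm_mult)
  qed
  have inner: "(\<Sum>\<^sub>\<infinity>y. P x y) = (\<Sum>\<^sub>\<infinity>l. X x l) / complex_of_real (sqrt s1)" for x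
  proof -
    define u where "u = of_int x + h"
    define K where "K = complex_of_real (exp (- (pi * s2) * u\<^sup>2))"
    have P: "P x y = K * exp (- of_real (pi * s1) * (of_int y + of_real (B * u / (2 * C)))\<^sup>2 +
       2 * of_real pi * \<i> * of_real 0 * (of_int y + of_real (B * u / (2 * C))))" for y
    proof -
      have "- 2 * pi * t * (A * u\<^sup>2 + B * u * of_int y + C * (of_int y)\<^sup>2) =
          - (pi * s2) * u\<^sup>2 + (- (pi * s1) * (of_int y + B * u / (2 * C))\<^sup>2)"
        using C by (simp add: s1_def s2_def \<Delta>_def field_simps power2_eq_square)
      then have "P x y = K * complex_of_real (exp (- (pi * s1) * (of_int y + B * u / (2 * C))\<^sup>2))"
        unfolding P_def u_def[symmetric] K_def by (simp only: exp_add of_real_mult)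
      then show ?thesis by (simp add: exp_of_real[symmetric])
    qed
    have X: "X x l = K * exp (- of_real (pi / s1) * (of_int l - of_real 0)\<^sup>2 +
       2 * of_real pi * \<i> * of_int l * of_real (B * u / (2 * C)))" for l
      unfolding X_def K_def u_def[symmetric] exp_add \<xi>_def
      by (simp add: exp_of_real[symmetric] cis_conv_exp mult_ac)
    show ?thesis
      unfolding P X infsum_cmult_right' poisson_summation_gaussian[OF s(1)] by simp
  qed
  have outer: "(\<Sum>\<^sub>\<infinity>x. X x l) = (\<Sum>\<^sub>\<infinity>m. R m l) / complex_of_real (sqrt s2)" for l
  proof -
    define K where "K = complex_of_real (exp (- (pi / s1) * (of_int l)\<^sup>2))"
    have X: "X x l = K * exp (- of_real (pi * s2) * (of_int x + of_real h)\<^sup>2 +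
       2 * of_real pi * \<i> * of_real (\<xi> l) * (of_int x + of_real h))" for x
      unfolding X_def K_def exp_add by (simp add: exp_of_real[symmetric] cis_conv_exp algebra_simps)
    have R: "R m l = K * exp (- of_real (pi / s2) * (of_int m - of_real (\<xi> l))\<^sup>2 +
       2 * of_real pi * \<i> * of_int m * of_real h)" for m
    proof -
      have "- 2 * pi / (t * \<Delta>) * (C * (of_int m)\<^sup>2 - B * of_int m * of_int l + A * (of_int l)\<^sup>2) =
          - (pi / s1) * (of_int l)\<^sup>2 + (- (pi / s2) * (of_int m - \<xi> l)\<^sup>2)"
      proof -
        have "A = (\<Delta> + B\<^sup>2) / (4 * C)" using C by (simp add: \<Delta>_def)
        then show ?thesis
          using C t \<Delta> by (simp add: s1_def s2_def \<xi>_def) (simp add: field_simps power2_eq_square)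
      qed
      then have "R m l = K * complex_of_real (exp (- (pi / s2) * (of_int m - \<xi> l)\<^sup>2)) * cis (2 * pi * of_int m * h)"
        unfolding R_def K_def by (simp only: exp_add of_real_mult)
      then show ?thesis unfolding exp_add by (simp add: exp_of_real[symmetric] cis_conv_exp mult_ac)
    qed
    show ?thesis
      unfolding X R infsum_cmult_right' poisson_summation_gaussian[OF s(2)] by simp
  qed
  have "sqrt s1 * sqrt s2 = sqrt (t\<^sup>2 * \<Delta>)"
    unfolding real_sqrt_mult[symmetric] using C by (simp add: s1_def s2_def power2_eq_square)
  also have "\<dots> = t * sqrt \<Delta>" using t by (simp add: real_sqrt_mult)
  finally have sq: "complex_of_real (sqrt s1) * complex_of_real (sqrt s2) = complex_of_real (t * sqrt \<Delta>)"
    by (metis of_real_mult)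
  have "(\<Sum>\<^sub>\<infinity>(x, y). P x y) = (\<Sum>\<^sub>\<infinity>x. \<Sum>\<^sub>\<infinity>y. P x y)"
    using infsum_Sigma'_banach[of P UNIV "\<lambda>_. UNIV"] sumP by simp
  also have "\<dots> = (\<Sum>\<^sub>\<infinity>x. \<Sum>\<^sub>\<infinity>l. X x l) / complex_of_real (sqrt s1)"
    unfolding inner divide_inverse infsum_cmult_left' ..
  also have "(\<Sum>\<^sub>\<infinity>x. \<Sum>\<^sub>\<infinity>l. X x l) = (\<Sum>\<^sub>\<infinity>l. \<Sum>\<^sub>\<infinity>x. X x l)"
    using infsum_swap_banach[of X UNIV UNIV] sumX by simp
  also have "\<dots> = (\<Sum>\<^sub>\<infinity>l. \<Sum>\<^sub>\<infinity>m. R m l) / complex_of_real (sqrt s2)"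
    unfolding outer divide_inverse infsum_cmult_left' ..
  also have "(\<Sum>\<^sub>\<infinity>l. \<Sum>\<^sub>\<infinity>m. R m l) = (\<Sum>\<^sub>\<infinity>m. \<Sum>\<^sub>\<infinity>l. R m l)"
    using infsum_swap_banach[of R UNIV UNIV] sumR by simp
  also have "\<dots> = (\<Sum>\<^sub>\<infinity>(m, l). R m l)"
    using infsum_Sigma'_banach[of R UNIV "\<lambda>_. UNIV"] sumR by simp
  finally show ?thesis
    unfolding P_def R_def sq[symmetric] by (simp only: divide_divide_eq_left mult.commute)
qed

section \<open>Transformation of theta series\<close>

lemma qform_theta_exp:
  "qform_theta (QForm a b c) z =
    (\<Sum>\<^sub>\<infinity>(x, y). exp (2 * of_real pi * \<i> * z * of_int (qform_eval (QForm a b c) x y)))"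
  unfolding qform_theta_def nome_def exp_power_int by (simp add: mult_ac)

lemma norm_exp_theta:
  "norm (exp (2 * of_real pi * \<i> * z * of_int k)) = exp (- (2 * pi * Im z) * of_int k)"
  by simp

lemma summable_on_exp_qform:
  assumes "a > 0" "4 * a * c - b\<^sup>2 > 0" "t > 0"
  shows "(\<lambda>(x, y). exp (- t * of_int (qform_eval (QForm a b c) x y)) :: real) summable_on UNIV"
proof -
  have "0 < 4 * a * c" using assms(2) zero_le_power2[of b] by linarith
  then have c: "real_of_int c > 0" using assms(1) by (simp add: zero_less_mult_iff)
  have "real_of_int (4 * a * c - b\<^sup>2) > 0" using assms(2) by linarith
  then have d: "4 * real_of_int a * of_int c - (of_int b)\<^sup>2 > 0" by simp
  show ?thesis
    using summable_on_exp_quadratic[OF c d assms(3), of 0] by (simp add: case_prod_unfold)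
qed

lemma summable_on_qform_theta:
  assumes "a > 0" "4 * a * c - b\<^sup>2 > 0" "Im z > 0"
  shows "(\<lambda>(x, y). exp (2 * of_real pi * \<i> * z * of_int (qform_eval (QForm a b c) x y))) summable_on UNIV"
proof (rule abs_summable_summable)
  show "(\<lambda>p. norm (case p of (x, y) \<Rightarrow> exp (2 * of_real pi * \<i> * z * of_int (qform_eval (QForm a b c) x y)))) summable_on UNIV"
    using summable_on_exp_qform[OF assms(1,2), of "2 * pi * Im z"] assms(3)
    by (simp only: case_prod_unfold norm_exp_theta) simp
qed

lemma qform_eval_nonneg:
  assumes "a > 0" "4 * a * c - b\<^sup>2 > 0"
  shows "qform_eval (QForm a b c) x y \<ge> 0"
proof -
  have "4 * a * qform_eval (QForm a b c) x y = (2 * a * x + b * y)\<^sup>2 + (4 * a * c - b\<^sup>2) * y\<^sup>2"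
    by (simp add: algebra_simps power2_eq_square)
  also have "\<dots> \<ge> 0" using assms by (intro add_nonneg_nonneg mult_nonneg_nonneg) auto
  finally show ?thesis using assms(1) by (simp only: zero_le_mult_iff) auto
qed

lemma holomorphic_qform_theta:
  assumes "a > 0" "4 * a * c - b\<^sup>2 > 0"
  shows "qform_theta (QForm a b c) holomorphic_on {z. Im z > 0}"
proof -
  have "(\<lambda>z. \<Sum>\<^sub>\<infinity>p. case p of (x, y) \<Rightarrow> exp (2 * of_real pi * \<i> * z * of_int (qform_eval (QForm a b c) x y)))
      holomorphic_on {z. Im z > 0}"
  proof (rule holomorphic_on_infsum)
    show "(\<lambda>z. case p of (x, y) \<Rightarrow> exp (2 * of_real pi * \<i> * z * of_int (qform_eval (QForm a b c) x y)))
      holomorphic_on {z. Im z > 0}" for p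
      by (cases p) (simp only: prod.case, intro holomorphic_intros)
    fix z :: complex assume "z \<in> {z. Im z > 0}"
    then have z: "Im z > 0" by simp
    have near: "Im w \<ge> Im z / 2" if "w \<in> cball z (Im z / 2)" for w
      using that abs_Im_le_cmod[of "z - w"] by (simp add: dist_norm)
    define M where "M = (\<lambda>(x, y). exp (- (pi * Im z) * of_int (qform_eval (QForm a b c) x y)) :: real)"
    show "\<exists>r>0. \<exists>M. cball z r \<subseteq> {z. Im z > 0} \<and> M summable_on UNIV \<and>
        (\<forall>p\<in>UNIV. \<forall>w\<in>cball z r. norm (case p of (x, y) \<Rightarrow>
           exp (2 * of_real pi * \<i> * w * of_int (qform_eval (QForm a b c) x y))) \<le> M p)"
    proof (intro exI[of _ "Im z / 2"] exI[of _ M] conjI ballI)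
      show "cball z (Im z / 2) \<subseteq> {z. Im z > 0}" using near z by force
      show "M summable_on UNIV" unfolding M_def using assms z by (intro summable_on_exp_qform) auto
      fix p :: "int \<times> int" and w assume w: "w \<in> cball z (Im z / 2)"
      obtain x y where p: "p = (x, y)" by fastforce
      define q where "q = qform_eval (QForm a b c) x y"
      have "real_of_int q \<ge> 0" using qform_eval_nonneg[OF assms, of x y] unfolding q_def of_int_0_le_iff .
      then have "pi * Im z * of_int q \<le> 2 * pi * Im w * of_int q"
        using near[OF w] by (intro mult_right_mono) auto
      then show "norm (case p of (x, y) \<Rightarrow> exp (2 * of_real pi * \<i> * w * of_int (qform_eval (QForm a b c) x y))) \<le> M p"
        by (simp only: p prod.case M_def q_def[symmetric] norm_exp_theta) simp
    qed (use z in auto)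
  qed
  then show ?thesis by (simp add: qform_theta_exp[abs_def] fun_eq_iff cong: holomorphic_cong)
qed

lemma qform_theta_eqI:
  assumes "bij \<phi>" and "\<And>x y. qform_eval P x y = (case \<phi> (x, y) of (u, v) \<Rightarrow> qform_eval Q u v)"
  shows "qform_theta P z = qform_theta Q z"
proof -
  have "qform_theta P z = (\<Sum>\<^sub>\<infinity>p. (\<lambda>(u, v). nome z powi qform_eval Q u v) (\<phi> p))"
    unfolding qform_theta_def by (rule infsum_cong) (simp add: assms(2) case_prod_unfold)
  also have "\<dots> = qform_theta Q z"
    unfolding qform_theta_def by (rule infsum_reindex_bij_betw[OF assms(1)])
  finally show ?thesis .
qed

lemma qform_theta_unimodular:
  assumes det: "s * v - t * u = (1::int)"
    and eval: "\<And>x y. qform_eval P x y = qform_eval Q (s * x + t * y) (u * x + v * y)"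
  shows "qform_theta P z = qform_theta Q z"
proof (rule qform_theta_eqI)
  have 1: "v * (s * x + t * y) - t * (u * x + v * y) = (s * v - t * u) * x" for x y
    by (simp add: algebra_simps)
  have 2: "s * (u * x + v * y) - u * (s * x + t * y) = (s * v - t * u) * y" for x y
    by (simp add: algebra_simps)
  have 3: "s * (v * x - t * y) + t * (s * y - u * x) = (s * v - t * u) * x" for x y
    by (simp add: algebra_simps)
  have 4: "u * (v * x - t * y) + v * (s * y - u * x) = (s * v - t * u) * y" for x y
    by (simp add: algebra_simps)
  show "bij (\<lambda>(x, y). (s * x + t * y, u * x + v * y))"
    by (rule o_bij[of "\<lambda>(x, y). (v * x - t * y, s * y - u * x)"])
       (simp_all add: fun_eq_iff 1 2 3 4 det del: distrib_left)
qed (simp add: eval)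

section \<open>Additive characters and Gauss sums modulo \<open>p\<close>\<close>

definition cisq :: "int \<Rightarrow> int \<Rightarrow> complex" where
  "cisq p k = cis (2 * pi * of_int k / of_int p)"

lemma cisq_add: "cisq p (j + k) = cisq p j * cisq p k"
  by (simp add: cisq_def cis_mult add_divide_distrib ring_distribs)

lemma cisq_cong:
  assumes "[j = k] (mod p)"
  shows "cisq p j = cisq p k"
proof (cases "p = 0")
  case False
  obtain m where "j = k + p * m" using assms by (metis cong_iff_lin cong_sym)
  then have "cisq p j = cisq p k * cisq p (p * m)" by (simp add: cisq_add)
  also have "cisq p (p * m) = 1"
    using False cis_multiple_2pi[of "of_int m"] by (simp add: cisq_def mult.assoc)
  finally show ?thesis by simp
qed (use assms in simp)

definition gauss_sum :: "int \<Rightarrow> int \<Rightarrow> complex" where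
  "gauss_sum p c = (\<Sum>k\<in>{0..<p}. cisq p (c * k\<^sup>2))"

lemma sum_residues_reindex:
  fixes f :: "int \<Rightarrow> complex"
  assumes p: "p > 0" and cong: "\<And>j k. [j = k] (mod p) \<Longrightarrow> f j = f k" and co: "coprime r p"
  shows "(\<Sum>k\<in>{0..<p}. f (r * k + w)) = (\<Sum>k\<in>{0..<p}. f k)"
proof -
  have inj: "inj_on (\<lambda>k. (r * k + w) mod p) {0..<p}"
  proof (rule inj_onI)
    fix j k assume jk: "j \<in> {0..<p}" "k \<in> {0..<p}" "(r * j + w) mod p = (r * k + w) mod p"
    then have "[r * j = r * k] (mod p)" by (simp add: cong_def[symmetric] cong_add_rcancel)
    then have "[j = k] (mod p)" using co by (simp add: cong_mult_lcancel)
    then show "j = k" using jk by (simp add: cong_def)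
  qed
  moreover have "(\<lambda>k. (r * k + w) mod p) ` {0..<p} \<subseteq> {0..<p}" using p by auto
  ultimately have "(\<lambda>k. (r * k + w) mod p) ` {0..<p} = {0..<p}"
    by (intro card_subset_eq) (auto simp: card_image)
  then have "(\<Sum>k\<in>{0..<p}. f k) = (\<Sum>k\<in>{0..<p}. f ((r * k + w) mod p))"
    using sum.reindex[OF inj, of f] by simp
  also have "\<dots> = (\<Sum>k\<in>{0..<p}. f (r * k + w))"
    by (intro sum.cong cong) (auto simp: cong_def)
  finally show ?thesis ..
qed

text \<open>This is where the genus enters: forms whose leading coefficients are squares modulo
  \<open>p\<close> have the same Gauss sum in their transformation law, so that differences of their
  theta series transform as well.\<close>

lemma gauss_sum_square_mult:
  assumes "p > 0" "coprime r p" "[a = r\<^sup>2] (mod p)"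
  shows "gauss_sum p (j * a) = gauss_sum p j"
proof -
  have "gauss_sum p (j * a) = (\<Sum>k\<in>{0..<p}. cisq p (j * (r * k + 0)\<^sup>2))"
    unfolding gauss_sum_def
  proof (intro sum.cong cisq_cong refl)
    fix k
    have "[j * a * k\<^sup>2 = j * r\<^sup>2 * k\<^sup>2] (mod p)"
      using assms(3) by (intro cong_mult cong_refl)
    then show "[j * a * k\<^sup>2 = j * (r * k + 0)\<^sup>2] (mod p)" by (simp add: power_mult_distrib mult.assoc)
  qed
  also have "\<dots> = gauss_sum p j"
    unfolding gauss_sum_def using assms
    by (intro sum_residues_reindex) (auto intro!: cisq_cong cong_mult cong_pow cong_refl)
  finally show ?thesis .
qed

lemma infsum_residue_classes:
  fixes f :: "int \<Rightarrow> int \<Rightarrow> complex"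
  assumes p: "p > 0" and sum: "(\<lambda>(x, y). f x y) summable_on UNIV"
  shows "(\<Sum>\<^sub>\<infinity>(x, y). f x y) = (\<Sum>k\<in>{0..<p}. \<Sum>\<^sub>\<infinity>(X, y). f (p * X + k) y)"
proof -
  define \<phi> where "\<phi> = (\<lambda>(k, X, y). (p * X + k, y :: int))"
  have bij: "bij_betw \<phi> ({0..<p} \<times> UNIV) UNIV"
    by (rule bij_betw_byWitness[where f'="\<lambda>(x, y). (x mod p, x div p, y)"])
       (use p in \<open>auto simp: \<phi>_def\<close>)
  have "(\<Sum>\<^sub>\<infinity>(x, y). f x y) = (\<Sum>\<^sub>\<infinity>q\<in>{0..<p} \<times> UNIV. (\<lambda>(x, y). f x y) (\<phi> q))"
    by (rule infsum_reindex_bij_betw[OF bij, symmetric])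
  also have "(\<lambda>q. (\<lambda>(x, y). f x y) (\<phi> q)) = (\<lambda>(k, q). case q of (X, y) \<Rightarrow> f (p * X + k) y)"
    by (simp add: \<phi>_def fun_eq_iff)
  also have "(\<Sum>\<^sub>\<infinity>(k, q)\<in>{0..<p} \<times> UNIV. case q of (X, y) \<Rightarrow> f (p * X + k) y) =
      (\<Sum>\<^sub>\<infinity>k\<in>{0..<p}. \<Sum>\<^sub>\<infinity>q. case q of (X, y) \<Rightarrow> f (p * X + k) y)"
  proof (rule infsum_Sigma'_banach[symmetric])
    have "(\<lambda>q. (\<lambda>(x, y). f x y) (\<phi> q)) summable_on ({0..<p} \<times> UNIV)"
      using sum by (subst summable_on_reindex_bij_betw[OF bij])
    also have "(\<lambda>q. (\<lambda>(x, y). f x y) (\<phi> q)) = (\<lambda>(k, q). case q of (X, y) \<Rightarrow> f (p * X + k) y)"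
      by (simp add: \<phi>_def fun_eq_iff)
    finally show "(\<lambda>(k, q). case q of (X, y) \<Rightarrow> f (p * X + k) y) summable_on ({0..<p} \<times> UNIV)" .
  qed
  finally show ?thesis by simp
qed

lemma infsum_sum:
  fixes f :: "'a \<Rightarrow> 'b \<Rightarrow> complex"
  assumes "finite K" "\<And>k. k \<in> K \<Longrightarrow> f k summable_on A"
  shows "(\<Sum>\<^sub>\<infinity>x\<in>A. \<Sum>k\<in>K. f k x) = (\<Sum>k\<in>K. \<Sum>\<^sub>\<infinity>x\<in>A. f k x)"
proof -
  have "((\<lambda>x. \<Sum>k\<in>K. f k x) has_sum (\<Sum>k\<in>K. \<Sum>\<^sub>\<infinity>x\<in>A. f k x)) A"
    using assms
  proof (induction K rule: finite_induct)
    case (insert k K)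
    then show ?case by (simp add: has_sum_add)
  qed simp
  then show ?thesis by (rule infsumI)
qed

lemma exp_theta_split:
  "exp (2 * of_real pi * \<i> * ((of_int j + \<i> * of_real t) / of_int p) * of_int q) =
    cisq p (j * q) * complex_of_real (exp (- 2 * pi * t / of_int p * of_int q))"
proof -
  have "2 * of_real pi * \<i> * ((of_int j + \<i> * of_real t) / of_int p) * of_int q =
      \<i> * of_real (2 * pi * of_int (j * q) / of_int p) + of_real (- 2 * pi * t / of_int p * of_int q)"
    by (simp add: algebra_simps add_divide_distrib)
  then show ?thesis unfolding cisq_def cis_conv_exp by (simp only: exp_add exp_of_real)
qed

section \<open>Theta series at the points above the cusps j / p\<close>

text \<open>The last two coefficients are multiples of \<open>p\<close>, so the phase at (j + i t) /
  p depends only on \<open>x\<close> modulo \<open>p\<close>. Splitting x = p X + k and dividing by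
  \<open>p\<close> leaves the form with coefficients a p, p \<beta>, \<gamma> at (X + k / p, y). Its
  determinant term \<open>\<Delta>\<close> is \<open>p\<close>, and Poisson summation turns the
  residues \<open>k\<close> into a finite exponential sum.\<close>

lemma qform_theta_poisson:
  assumes a: "a > 0" and p: "p > 0" and t: "t > 0" and det: "4 * a * \<gamma> = 1 + p * \<beta>\<^sup>2"
  shows "qform_theta (QForm a (p * \<beta>) (p * \<gamma>)) ((of_int j + \<i> * of_real t) / of_int p) =
    (\<Sum>\<^sub>\<infinity>(m, l). complex_of_real (exp (- 2 * pi / (t * of_int p) * of_int (qform_eval (QForm \<gamma> (- p * \<beta>) (p * a)) m l))) *
      (\<Sum>k\<in>{0..<p}. cisq p (j * a * k\<^sup>2 + m * k))) / of_real (t * sqrt (of_int p))"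
proof -
  define Q where "Q = qform_eval (QForm a (p * \<beta>) (p * \<gamma>))"
  define Q' where "Q' = qform_eval (QForm \<gamma> (- p * \<beta>) (p * a))"
  define E where "E = (\<lambda>m l. complex_of_real (exp (- 2 * pi / (t * of_int p) * of_int (Q' m l))))"
  have "4 * a * \<gamma> > 0" using det p by (simp add: add_pos_nonneg)
  then have \<gamma>: "\<gamma> > 0" using a by (simp add: zero_less_mult_iff)
  have disc: "4 * a * (p * \<gamma>) - (p * \<beta>)\<^sup>2 = p"
  proof -
    have "4 * a * (p * \<gamma>) - (p * \<beta>)\<^sup>2 = p * (4 * a * \<gamma> - p * \<beta>\<^sup>2)" by (simp add: algebra_simps power2_eq_square)
    then show ?thesis using det by simp
  qed
  have disc_real: "4 * (real_of_int (a * p)) * of_int \<gamma> - (of_int (p * \<beta>))\<^sup>2 = real_of_int p"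
    using arg_cong[OF disc, of real_of_int] by (simp add: mult_ac)
  have disc': "4 * \<gamma> * (p * a) - (- p * \<beta>)\<^sup>2 = p" using disc by (simp add: mult_ac)
  have pos': "4 * \<gamma> * (p * a) - (- p * \<beta>)\<^sup>2 > 0" unfolding disc' by (rule p)
  have summable_E: "(\<lambda>(m, l). E m l * cisq p (f m)) summable_on UNIV" for f
  proof (rule abs_summable_summable)
    have "norm (E m l * cisq p k) = exp (- (2 * pi / (t * of_int p)) * of_int (Q' m l))" for m l k
      by (simp add: E_def cisq_def norm_mult)
    then show "(\<lambda>q. norm (case q of (m, l) \<Rightarrow> E m l * cisq p (f m))) summable_on UNIV"
      using summable_on_exp_qform[OF \<gamma> pos', of "2 * pi / (t * of_int p)"] p t
      by (simp only: Q'_def case_prod_unfold) simp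
  qed
  have "qform_theta (QForm a (p * \<beta>) (p * \<gamma>)) ((of_int j + \<i> * of_real t) / of_int p) =
      (\<Sum>\<^sub>\<infinity>(x, y). cisq p (j * Q x y) * complex_of_real (exp (- 2 * pi * t / of_int p * of_int (Q x y))))"
    unfolding qform_theta_exp exp_theta_split Q_def ..
  also have "\<dots> = (\<Sum>k\<in>{0..<p}. \<Sum>\<^sub>\<infinity>(X, y). cisq p (j * Q (p * X + k) y) *
      complex_of_real (exp (- 2 * pi * t / of_int p * of_int (Q (p * X + k) y))))"
  proof (rule infsum_residue_classes[OF p])
    have "(\<lambda>(x, y). exp (2 * of_real pi * \<i> * ((of_int j + \<i> * of_real t) / of_int p) * of_int (Q x y))) summable_on UNIV"
      unfolding Q_def using a p t disc by (intro summable_on_qform_theta) auto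
    then show "(\<lambda>(x, y). cisq p (j * Q x y) * complex_of_real (exp (- 2 * pi * t / of_int p * of_int (Q x y)))) summable_on UNIV"
      unfolding exp_theta_split .
  qed
  also have "\<dots> = (\<Sum>k\<in>{0..<p}. (\<Sum>\<^sub>\<infinity>(m, l). E m l * cisq p (j * a * k\<^sup>2 + m * k)) / of_real (t * sqrt (of_int p)))"
  proof (intro sum.cong refl)
    fix k
    have "cisq p (j * Q (p * X + k) y) = cisq p (j * a * k\<^sup>2)" for X y
    proof (rule cisq_cong)
      have "j * Q (p * X + k) y = j * a * k\<^sup>2 + p * (j * (a * (p * X\<^sup>2 + 2 * X * k) + \<beta> * (p * X + k) * y + \<gamma> * y\<^sup>2))"
        by (simp add: Q_def algebra_simps power2_eq_square)
      then show "[j * Q (p * X + k) y = j * a * k\<^sup>2] (mod p)" by (simp add: cong_def)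
    qed
    moreover have "- 2 * pi * t / of_int p * of_int (Q (p * X + k) y) = - 2 * pi * t *
        (of_int (a * p) * (of_int X + of_int k / of_int p)\<^sup>2 +
         of_int (p * \<beta>) * (of_int X + of_int k / of_int p) * of_int y + of_int \<gamma> * (of_int y)\<^sup>2)" for X y
      using p by (simp add: Q_def field_simps power2_eq_square)
    ultimately have "(\<Sum>\<^sub>\<infinity>(X, y). cisq p (j * Q (p * X + k) y) *
        complex_of_real (exp (- 2 * pi * t / of_int p * of_int (Q (p * X + k) y)))) =
      (\<Sum>\<^sub>\<infinity>q. cisq p (j * a * k\<^sup>2) * (case q of (X, y) \<Rightarrow> complex_of_real (exp (- 2 * pi * t *
        (of_int (a * p) * (of_int X + of_int k / of_int p)\<^sup>2 +
         of_int (p * \<beta>) * (of_int X + of_int k / of_int p) * of_int y + of_int \<gamma> * (of_int y)\<^sup>2)))))"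
      by (simp only: case_prod_unfold)
    also have "\<dots> = cisq p (j * a * k\<^sup>2) * ((\<Sum>\<^sub>\<infinity>(m, l). complex_of_real (exp (- 2 * pi / (t * of_int p) *
      (of_int \<gamma> * (of_int m)\<^sup>2 - of_int (p * \<beta>) * of_int m * of_int l + of_int (a * p) * (of_int l)\<^sup>2))) *
        cis (2 * pi * of_int m * (of_int k / of_int p))) / complex_of_real (t * sqrt (of_int p)))"
      unfolding infsum_cmult_right'
      by (subst poisson_summation_quadratic, unfold disc_real) (use \<gamma> p t in auto)
    also have "\<dots> = (\<Sum>\<^sub>\<infinity>q. cisq p (j * a * k\<^sup>2) * (case q of (m, l) \<Rightarrow> complex_of_real (exp (- 2 * pi / (t * of_int p) *
      (of_int \<gamma> * (of_int m)\<^sup>2 - of_int (p * \<beta>) * of_int m * of_int l + of_int (a * p) * (of_int l)\<^sup>2))) *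
        cis (2 * pi * of_int m * (of_int k / of_int p)))) / complex_of_real (t * sqrt (of_int p))"
      by (simp only: infsum_cmult_right' times_divide_eq_right)
    also have "\<dots> = (\<Sum>\<^sub>\<infinity>(m, l). E m l * cisq p (j * a * k\<^sup>2 + m * k)) / of_real (t * sqrt (of_int p))"
    proof (rule arg_cong[where f="\<lambda>x. x / _"], rule infsum_cong)
      fix q :: "int \<times> int"
      obtain m l where q: "q = (m, l)" by fastforce
      have "cis (2 * pi * of_int m * (of_int k / of_int p)) = cisq p (m * k)" by (simp add: cisq_def mult.assoc)
      moreover have "complex_of_real (exp (- 2 * pi / (t * of_int p) *
          (of_int \<gamma> * (of_int m)\<^sup>2 - of_int (p * \<beta>) * of_int m * of_int l + of_int (a * p) * (of_int l)\<^sup>2))) = E m l"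
        by (simp add: E_def Q'_def mult_ac)
      ultimately show "cisq p (j * a * k\<^sup>2) * (case q of (m, l) \<Rightarrow> complex_of_real (exp (- 2 * pi / (t * of_int p) *
          (of_int \<gamma> * (of_int m)\<^sup>2 - of_int (p * \<beta>) * of_int m * of_int l + of_int (a * p) * (of_int l)\<^sup>2))) *
          cis (2 * pi * of_int m * (of_int k / of_int p))) =
          (case q of (m, l) \<Rightarrow> E m l * cisq p (j * a * k\<^sup>2 + m * k))"
        by (simp add: q cisq_add mult_ac)
    qed
    finally show "(\<Sum>\<^sub>\<infinity>(X, y). cisq p (j * Q (p * X + k) y) *
        complex_of_real (exp (- 2 * pi * t / of_int p * of_int (Q (p * X + k) y)))) =
        (\<Sum>\<^sub>\<infinity>(m, l). E m l * cisq p (j * a * k\<^sup>2 + m * k)) / of_real (t * sqrt (of_int p))" .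
  qed
  also have "\<dots> = (\<Sum>k\<in>{0..<p}. \<Sum>\<^sub>\<infinity>(m, l). E m l * cisq p (j * a * k\<^sup>2 + m * k)) / of_real (t * sqrt (of_int p))"
    by (simp add: sum_divide_distrib)
  also have "(\<Sum>k\<in>{0..<p}. \<Sum>\<^sub>\<infinity>(m, l). E m l * cisq p (j * a * k\<^sup>2 + m * k)) =
      (\<Sum>\<^sub>\<infinity>q. \<Sum>k\<in>{0..<p}. case q of (m, l) \<Rightarrow> E m l * cisq p (j * a * k\<^sup>2 + m * k))"
    by (rule infsum_sum[symmetric]) (use summable_E in auto)
  also have "\<dots> = (\<Sum>\<^sub>\<infinity>(m, l). E m l * (\<Sum>k\<in>{0..<p}. cisq p (j * a * k\<^sup>2 + m * k)))"
    by (simp add: case_prod_unfold sum_distrib_left)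
  finally show ?thesis unfolding E_def Q'_def .
qed

text \<open>The point (j + i t) / p is sent to (j' + i / t) / p by a matrix of determinant 1 with
  lower row (p, -j), an element of the level \<open>p\<close> group. The law holds because the
  finite sum of the Poisson formula is a Gauss sum times the phase of the dual form at j' /
  p.\<close>

lemma qform_theta_transform:
  assumes a: "a > 0" and p: "p > 0" and t: "t > 0" and det: "4 * a * \<gamma> = 1 + p * \<beta>\<^sup>2"
    and j': "[j * j' = - 1] (mod p)"
  shows "qform_theta (QForm a (p * \<beta>) (p * \<gamma>)) ((of_int j + \<i> * of_real t) / of_int p) =
    gauss_sum p (j * a) / of_real (t * sqrt (of_int p)) *
    qform_theta (QForm a (p * \<beta>) (p * \<gamma>)) ((of_int j' + \<i> * of_real (1 / t)) / of_int p)"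
proof -
  define Q' where "Q' = QForm \<gamma> (- p * \<beta>) (p * a)"
  \<comment> \<open>By \<open>det\<close>, \<open>4 * a * \<gamma>\<close> is 1 modulo
    \<open>p\<close>. The constant left by completing the square is then
    \<open>j' * \<gamma> * m\<^sup>2\<close>, which modulo \<open>p\<close> is \<open>j'\<close>
    times the dual form, the other coefficients of that form being multiples of
    \<open>p\<close>.\<close>
  have gauss: "(\<Sum>k\<in>{0..<p}. cisq p (j * a * k\<^sup>2 + m * k)) = gauss_sum p (j * a) * cisq p (j' * qform_eval Q' m l)" for m l
  proof -
    define w where "w = - 2 * j' * \<gamma> * m" \<comment> \<open>completes the square: \<open>2 * j * a * w\<close> is congruent to \<open>m\<close>\<close>
    obtain r where r: "j * j' = - 1 + p * r" using j' by (metis cong_iff_lin cong_sym)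
    have "[j * a * k\<^sup>2 + m * k = j * a * (1 * k + w)\<^sup>2 + j' * qform_eval Q' m l] (mod p)" for k
    proof -
      have "j * a * (1 * k + w)\<^sup>2 + j' * qform_eval Q' m l - (j * a * k\<^sup>2 + m * k) =
          - (4 * a * \<gamma>) * (j * j') * m * k - m * k + (4 * a * \<gamma>) * (j * j') * j' * \<gamma> * m\<^sup>2 + j' * \<gamma> * m\<^sup>2 +
          p * (j' * (a * l\<^sup>2 - \<beta> * m * l))"
        by (simp add: w_def Q'_def algebra_simps power2_eq_square)
      also have "\<dots> = p * ((\<beta>\<^sup>2 - r - p * \<beta>\<^sup>2 * r) * m * k + (- \<beta>\<^sup>2 + r + p * \<beta>\<^sup>2 * r) * j' * \<gamma> * m\<^sup>2 + j' * (a * l\<^sup>2 - \<beta> * m * l))"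
        unfolding det r by (simp add: algebra_simps)
      finally have "p dvd j * a * (1 * k + w)\<^sup>2 + j' * qform_eval Q' m l - (j * a * k\<^sup>2 + m * k)" by simp
      then show ?thesis by (metis cong_iff_dvd_diff cong_sym)
    qed
    then have "(\<Sum>k\<in>{0..<p}. cisq p (j * a * k\<^sup>2 + m * k)) =
        (\<Sum>k\<in>{0..<p}. cisq p (j * a * (1 * k + w)\<^sup>2) * cisq p (j' * qform_eval Q' m l))"
      unfolding cisq_add[symmetric] by (intro sum.cong refl cisq_cong)
    also have "\<dots> = (\<Sum>k\<in>{0..<p}. cisq p (j * a * (1 * k + w)\<^sup>2)) * cisq p (j' * qform_eval Q' m l)"
      by (simp only: sum_distrib_right)
    also have "(\<Sum>k\<in>{0..<p}. cisq p (j * a * (1 * k + w)\<^sup>2)) = gauss_sum p (j * a)"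
      unfolding gauss_sum_def using p
      by (intro sum_residues_reindex) (auto intro!: cisq_cong cong_mult cong_pow cong_refl)
    finally show ?thesis .
  qed
  have summand: "complex_of_real (exp (- 2 * pi / (t * of_int p) * of_int (qform_eval Q' m l))) *
      (\<Sum>k\<in>{0..<p}. cisq p (j * a * k\<^sup>2 + m * k)) =
      gauss_sum p (j * a) * exp (2 * of_real pi * \<i> * ((of_int j' + \<i> * of_real (1 / t)) / of_int p) * of_int (qform_eval Q' m l))" for m l
    unfolding exp_theta_split gauss[of m l] by (simp add: mult_ac)
  \<comment> \<open>The dual form is properly equivalent to the original one: the matrix with rows
    (2 a, p \<beta>) and (\<beta>, 2 \<gamma>) has determinant 1 by \<open>det\<close>.\<close>
  have "qform_theta (QForm a (p * \<beta>) (p * \<gamma>)) z = qform_theta Q' z" for z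
  proof (rule qform_theta_unimodular)
    show 1: "(2 * a) * (2 * \<gamma>) - (p * \<beta>) * \<beta> = 1" using det by (simp add: power2_eq_square)
    fix x y
    have "qform_eval Q' (2 * a * x + p * \<beta> * y) (\<beta> * x + 2 * \<gamma> * y) =
        ((2 * a) * (2 * \<gamma>) - (p * \<beta>) * \<beta>) * qform_eval (QForm a (p * \<beta>) (p * \<gamma>)) x y"
      by (simp add: Q'_def algebra_simps power2_eq_square)
    then show "qform_eval (QForm a (p * \<beta>) (p * \<gamma>)) x y =
        qform_eval Q' (2 * a * x + p * \<beta> * y) (\<beta> * x + 2 * \<gamma> * y)"
      by (simp only: 1)
  qed
  then show ?thesis
    unfolding qform_theta_poisson[OF a p t det] Q'_def[symmetric] summand
    by (simp only: case_prod_unfold infsum_cmult_right' qform_theta_exp Q'_def) (simp add: case_prod_unfold)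
qed

lemma sum_cisq:
  assumes p: "p > 0"
  shows "(\<Sum>k\<in>{0..<p}. cisq p (m * k)) = (if p dvd m then of_int p else 0)"
proof (cases "p dvd m")
  case True
  then have "cisq p (m * k) = cisq p 0" for k by (intro cisq_cong) (simp add: cong_0_iff)
  then show ?thesis using True p by (simp add: cisq_def)
next
  case False
  define S where "S = (\<Sum>k\<in>{0..<p}. cisq p (m * k))"
  have "S = (\<Sum>k\<in>{0..<p}. cisq p (m * (1 * k + 1)))"
    unfolding S_def using p
    by (intro sum_residues_reindex[symmetric]) (auto intro!: cisq_cong cong_mult cong_refl)
  also have "\<dots> = cisq p m * S"
    by (simp add: S_def cisq_add distrib_left sum_distrib_left mult.commute)
  finally have "(1 - cisq p m) * S = 0" by (simp add: algebra_simps)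
  moreover have "cisq p m \<noteq> 1"
  proof
    assume "cisq p m = 1"
    then have "exp (\<i> * of_real (2 * pi * of_int m / of_int p)) = 1" by (simp add: cisq_def cis_conv_exp)
    then obtain n :: int where "2 * pi * of_int m / of_int p = of_int (2 * n) * pi"
      by (auto simp: exp_eq_1)
    then have "real_of_int m = of_int (n * p)" using p by (simp add: field_simps)
    then have "m = n * p" by (simp only: of_int_eq_iff)
    then show False using False by simp
  qed
  ultimately show ?thesis using False by (simp add: S_def)
qed

text \<open>The Fricke involution sending z to -1 / (p z), on the imaginary axis. For j = 0 the
  finite sum is \<open>p\<close> on multiples of \<open>p\<close> and zero elsewhere. Putting m = p
  M takes a factor \<open>p\<close> out of the dual form, and what remains, \<open>Q3\<close>, is
  the original form after a quarter turn.\<close>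

lemma qform_theta_transform_0:
  assumes a: "a > 0" and p: "p > 0" and t: "t > 0" and det: "4 * a * \<gamma> = 1 + p * \<beta>\<^sup>2"
  shows "qform_theta (QForm a (p * \<beta>) (p * \<gamma>)) (\<i> * of_real t / of_int p) =
    of_real (sqrt (of_int p) / t) * qform_theta (QForm a (p * \<beta>) (p * \<gamma>)) (\<i> * of_real (1 / t))"
proof -
  define Q' where "Q' = QForm \<gamma> (- p * \<beta>) (p * a)"
  define Q3 where "Q3 = QForm (p * \<gamma>) (- p * \<beta>) a"
  define E where "E = (\<lambda>m l. complex_of_real (exp (- 2 * pi / (t * of_int p) * of_int (qform_eval Q' m l))))"
  have "qform_theta (QForm a (p * \<beta>) (p * \<gamma>)) ((of_int 0 + \<i> * of_real t) / of_int p) =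
     (\<Sum>\<^sub>\<infinity>(m, l). E m l * (\<Sum>k\<in>{0..<p}. cisq p (0 * a * k\<^sup>2 + m * k))) / of_real (t * sqrt (of_int p))"
    unfolding qform_theta_poisson[OF a p t det] E_def Q'_def ..
  also have "(\<lambda>(m, l). E m l * (\<Sum>k\<in>{0..<p}. cisq p (0 * a * k\<^sup>2 + m * k))) =
      (\<lambda>(m, l). E m l * (if p dvd m then of_int p else 0))"
    by (simp add: sum_cisq[OF p])
  also have "(\<Sum>\<^sub>\<infinity>(m, l). E m l * (if p dvd m then of_int p else 0)) =
      (\<Sum>\<^sub>\<infinity>(m, l)\<in>range (\<lambda>(M, l). (p * M, l)). E m l * of_int p)"
    by (rule infsum_cong_neutral) (auto simp: image_iff dvd_def)
  also have "\<dots> = (\<Sum>\<^sub>\<infinity>(M, l). E (p * M) l * of_int p)"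
    using p by (subst infsum_reindex) (auto simp: inj_def o_def case_prod_unfold)
  also have "(\<lambda>(M, l). E (p * M) l * of_int p) =
      (\<lambda>(M, l). of_int p * exp (2 * of_real pi * \<i> * (\<i> * of_real (1 / t)) * of_int (qform_eval Q3 M l)))"
  proof -
    have "E (p * M) l = exp (2 * of_real pi * \<i> * (\<i> * of_real (1 / t)) * of_int (qform_eval Q3 M l))" for M l
    proof -
      have "qform_eval Q' (p * M) l = p * qform_eval Q3 M l"
        by (simp add: Q'_def Q3_def algebra_simps power2_eq_square)
      then have "- 2 * pi / (t * of_int p) * of_int (qform_eval Q' (p * M) l) = - 2 * pi / t * of_int (qform_eval Q3 M l)"
        using p t by (simp add: field_simps)
      then show ?thesis unfolding E_def by (simp add: exp_of_real[symmetric] algebra_simps)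
    qed
    then show ?thesis by (simp add: mult.commute)
  qed
  also have "(\<Sum>\<^sub>\<infinity>(M, l). of_int p * exp (2 * of_real pi * \<i> * (\<i> * of_real (1 / t)) * of_int (qform_eval Q3 M l))) =
      of_int p * qform_theta Q3 (\<i> * of_real (1 / t))"
    by (simp only: case_prod_unfold infsum_cmult_right' qform_theta_exp Q3_def)
  also have "qform_theta Q3 (\<i> * of_real (1 / t)) = qform_theta (QForm a (p * \<beta>) (p * \<gamma>)) (\<i> * of_real (1 / t))"
    by (rule qform_theta_unimodular[where s=0 and t=1 and u="-1" and v=0])
       (simp_all add: Q3_def algebra_simps)
  also have "of_int p * qform_theta (QForm a (p * \<beta>) (p * \<gamma>)) (\<i> * of_real (1 / t)) / complex_of_real (t * sqrt (of_int p)) =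
     of_real (sqrt (of_int p) / t) * qform_theta (QForm a (p * \<beta>) (p * \<gamma>)) (\<i> * of_real (1 / t))"
  proof -
    have "complex_of_int p = of_real (sqrt (of_int p)) * of_real (sqrt (of_int p))"
      using p by (simp flip: of_real_mult)
    then show ?thesis using p t by (simp add: field_simps)
  qed
  finally show ?thesis by simp
qed

section \<open>Forms of prime discriminant\<close>

lemma Legendre_eq_1D: "Legendre a p = 1 \<Longrightarrow> QuadRes p a"
  by (auto simp: Legendre_def split: if_splits)

text \<open>For P congruent to 3 modulo 4 the sign in the reciprocity law is (-1)^((l - 1) / 2), the
  Legendre symbol of -1 modulo \<open>l\<close>. Hence the symbol of \<open>l\<close> modulo
  \<open>P\<close> equals that of -P modulo \<open>l\<close>.\<close>

lemma QuadRes_prime_reciprocity: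
  fixes P l :: nat
  assumes P: "prime P" "P mod 4 = 3" and l: "prime l" "l > 2" "l \<noteq> P"
    and res: "QuadRes (int l) (- int P)"
  shows "QuadRes (int P) (int l)"
proof -
  define e where "e = (l - 1) div 2"
  define L where "L = Legendre (int P) (int l)"
  have P2: "P > 2" using P prime_ge_2_nat[of P] by (cases "P = 2") auto
  have ndvd: "\<not> int l dvd int P" using P(1) l by (auto simp: primes_dvd_imp_eq)
  then have "Legendre (- int P) (int l) = 1"
    using res by (auto simp: Legendre_def cong_0_iff)
  then have "[1 = (- int P) ^ e] (mod int l)"
    using euler_criterion[OF l(1,2), of "- int P"] by (simp add: e_def)
  moreover have "(- int P) ^ e = (- 1) ^ e * int P ^ e" by (metis mult_minus1 power_mult_distrib)
  moreover have "[L = int P ^ e] (mod int l)"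
    unfolding L_def e_def by (rule euler_criterion[OF l(1,2)])
  ultimately have "[1 = (- 1) ^ e * L] (mod int l)"
    by (metis cong_scalar_left cong_sym cong_trans)
  then have d: "int l dvd 1 - (- 1) ^ e * L" by (simp add: cong_iff_dvd_diff)
  have sgn: "(- 1 :: int) ^ e = 1 \<or> (- 1 :: int) ^ e = - 1" by (cases "even e") auto
  have "L = 1 \<or> L = - 1" using ndvd by (auto simp: L_def Legendre_def cong_0_iff)
  have eq: "L = (- 1) ^ e"
  proof (rule ccontr)
    assume "L \<noteq> (- 1) ^ e"
    then have "(- 1) ^ e * L = - 1" using sgn \<open>L = 1 \<or> L = - 1\<close> by auto
    then have "int l dvd 2" using d by simp
    then show False using l(2) zdvd_imp_le by fastforce
  qed
  have "odd ((P - 1) div 2)" using P(2) by presburger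
  then have "(- 1 :: int) ^ ((P - 1) div 2 * e) = (- 1) ^ e" by (simp add: power_mult)
  then have "L * Legendre (int l) (int P) = (- 1) ^ e"
    using Quadratic_Reciprocity[OF P(1) P2 l(1,2)] l(3) by (simp add: L_def e_def)
  then have "Legendre (int l) (int P) = 1" using eq sgn by auto
  then show ?thesis by (rule Legendre_eq_1D)
qed

lemma QuadRes_nat_prime_factors:
  fixes n :: nat
  assumes "n > 0" "\<And>l. prime l \<Longrightarrow> l dvd n \<Longrightarrow> QuadRes p (int l)"
  shows "QuadRes p (int n)"
  using assms
proof (induction n rule: less_induct)
  case (less n)
  show ?case
  proof (cases "n = 1")
    case True
    then show ?thesis unfolding QuadRes_def by (intro exI[of _ 1]) simp
  next
    case False
    obtain l where l: "prime l" "l dvd n" using prime_factor_nat False by blast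
    from l(2) obtain m where m: "n = l * m" ..
    have "m > 0" using m less.prems(1) by (cases "m = 0") auto
    moreover from this have "m < n" unfolding m using prime_gt_1_nat[OF l(1)] by simp
    moreover have "QuadRes p (int q)" if "prime q" "q dvd m" for q
      using less.prems(2)[OF that(1)] that(2) unfolding m by simp
    ultimately have "QuadRes p (int m)" using less.IH[of m] by blast
    then obtain y where y: "[y\<^sup>2 = int m] (mod p)" unfolding QuadRes_def ..
    obtain x where x: "[x\<^sup>2 = int l] (mod p)" using less.prems(2)[OF l] unfolding QuadRes_def ..
    have "[(x * y)\<^sup>2 = int n] (mod p)" using cong_mult[OF x y] unfolding m power_mult_distrib of_nat_mult .
    then show ?thesis unfolding QuadRes_def ..
  qed
qed

text \<open>For every prime \<open>l\<close> dividing \<open>a\<close>, the discriminant equation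
  makes -p congruent to b^2 modulo \<open>l\<close>, so reciprocity makes \<open>l\<close> a square
  modulo \<open>p\<close>; multiplying over the prime factors gives \<open>a\<close>. The bound a <
  p keeps \<open>p\<close> itself away from these factors.\<close>

lemma leading_coeff_QuadRes:
  fixes a b c p :: int
  assumes p: "prime p" "p mod 4 = 3" and a: "odd a" "0 < a" "a < p" and disc: "b\<^sup>2 - 4 * a * c = - p"
  obtains r where "coprime r p" "[a = r\<^sup>2] (mod p)"
proof -
  define P where "P = nat p"
  have P2: "p = int P" using prime_gt_0_int[OF p(1)] by (simp add: P_def)
  have P1: "prime P" using p(1) unfolding P2 by simp
  have "int (P mod 4) = 3" using p(2) unfolding P2 by (simp add: zmod_int)
  then have P: "prime P" "p = int P" "P mod 4 = 3" using P1 P2 by simp_all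
  have "QuadRes (int P) (int (nat a))"
  proof (rule QuadRes_nat_prime_factors)
    fix l assume l: "prime l" "l dvd nat a"
    then have la: "int l dvd a" using a by (metis int_dvd_int_iff int_nat_eq less_le)
    have "l \<noteq> 2" using la a(1) by auto
    then have "l > 2" using prime_ge_2_nat[OF l(1)] by simp
    moreover have "l \<noteq> P" using zdvd_imp_le[OF la a(2)] a(3) P(2) by auto
    moreover have "[b\<^sup>2 = - int P] (mod int l)"
    proof -
      have "b\<^sup>2 - - p = a * (4 * c)" using disc by simp
      then show ?thesis using la P(2) by (simp add: cong_iff_dvd_diff)
    qed
    then have "QuadRes (int l) (- int P)" unfolding QuadRes_def ..
    ultimately show "QuadRes (int P) (int l)"
      using P(1,3) l(1) QuadRes_prime_reciprocity[of P l] by blast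
  qed (use a in simp)
  then obtain r where r: "[r\<^sup>2 = a] (mod p)" using a P(2) unfolding QuadRes_def by auto
  have "\<not> p dvd r"
  proof
    assume "p dvd r"
    then have "p dvd r\<^sup>2" by (simp add: power2_eq_square)
    then have "p dvd a" using cong_dvd_iff[OF r] by simp
    then show False using a(2,3) zdvd_imp_le[of p a] by simp
  qed
  then have "coprime r p" using p(1) by (metis coprime_commute prime_imp_coprime)
  from that[OF this cong_sym[OF r]] show ?thesis .
qed

text \<open>Since \<open>p\<close> does not divide \<open>2 * a\<close>, a substitution \<open>x \<mapsto> x + n * y\<close> makes the middle coefficient divisible by \<open>p\<close>.\<close>

lemma qform_theta_level_form:
  fixes a b c p :: int
  assumes p: "prime p" and a: "0 < a" "a < p" "odd p" and disc: "b\<^sup>2 - 4 * a * c = - p"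
  obtains \<beta> \<gamma> where "4 * a * \<gamma> = 1 + p * \<beta>\<^sup>2"
    "\<And>z. qform_theta (QForm a b c) z = qform_theta (QForm a (p * \<beta>) (p * \<gamma>)) z"
proof -
  have "\<not> p dvd a" using a zdvd_imp_le by fastforce
  moreover have "\<not> p dvd 2" using a(3) p prime_ge_2_int[OF p] zdvd_imp_le[of p 2] by fastforce
  ultimately have nd: "\<not> p dvd 2 * a" using p by (simp add: prime_dvd_mult_iff)
  then have "coprime (2 * a) p" using p by (metis coprime_commute prime_imp_coprime)
  then obtain x where x: "[2 * a * x = 1] (mod p)" using cong_solve_coprime_int by blast
  define n where "n = - b * x"
  have "[2 * a * n = - b * 1] (mod p)" using cong_scalar_left[OF x, of "- b"] by (simp add: n_def mult_ac)
  then have "p dvd 2 * a * n + b" by (simp add: cong_iff_dvd_diff)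
  then obtain \<beta> where \<beta>: "2 * a * n + b = p * \<beta>" by auto
  define c' where "c' = a * n\<^sup>2 + b * n + c"
  have "(2 * a * n + b)\<^sup>2 - 4 * a * c' = b\<^sup>2 - 4 * a * c" by (simp add: c'_def algebra_simps power2_eq_square)
  then have d: "(p * \<beta>)\<^sup>2 - 4 * a * c' = - p" using disc \<beta> by simp
  then have "2 * (2 * a) * c' = p * (1 + p * \<beta>\<^sup>2)" by (simp add: algebra_simps power2_eq_square)
  then have "p dvd 2 * (2 * a) * c'" by simp
  then have "p dvd c'" using nd \<open>\<not> p dvd 2\<close> by (auto simp only: prime_dvd_mult_iff[OF p])
  then obtain \<gamma> where \<gamma>: "c' = p * \<gamma>" by auto
  have "p * (4 * a * \<gamma>) = p * (1 + p * \<beta>\<^sup>2)" using d \<gamma> by (simp add: algebra_simps power2_eq_square)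
  then have "4 * a * \<gamma> = 1 + p * \<beta>\<^sup>2" using p by auto
  moreover have "qform_theta (QForm a b c) z = qform_theta (QForm a (p * \<beta>) (p * \<gamma>)) z" for z
    by (rule qform_theta_unimodular[where s=1 and t="- n" and u=0 and v=1, symmetric, THEN sym])
       (simp_all flip: \<beta> \<gamma>, simp add: c'_def algebra_simps power2_eq_square)
  ultimately show ?thesis using that by blast
qed

text \<open>An odd leading coefficient spares the supplementary law for \<open>2\<close> in \<open>leading_coeff_QuadRes\<close>.\<close>

lemma odd_leading_coeff:
  fixes a b c p :: int
  assumes bac: "\<bar>b\<bar> < a" "a < c" "b \<noteq> 0" and disc: "b\<^sup>2 - 4 * a * c = - p" and p: "odd p"
  obtains a' b' c' where "odd a'" "0 < a'" "a' < p" "b'\<^sup>2 - 4 * a' * c' = - p"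
    "\<And>z. qform_theta (QForm a b c) z = qform_theta (QForm a' b' c') z"
proof -
  \<comment> \<open>As |b| < a < c and a >= 2, the discriminant equation yields p > 3 a c and p > 6
    c. So the values a, c and a + b + c < 3 c of the form at (1, 0), (0, 1) and (1, 1) all lie below
    \<open>p\<close>, and since b is odd one of them is odd.\<close>
  have "b\<^sup>2 < a * a" using bac abs_square_less_1 power_strict_mono[of "\<bar>b\<bar>" a 2] by (simp add: power2_eq_square)
  moreover have "a * a \<le> a * c" "2 * c \<le> a * c" using bac by (auto intro!: mult_left_mono mult_right_mono)
  ultimately have 6: "3 * (a * c) < p" "6 * c < p" using disc by (auto simp: mult.assoc)
  have "odd (b\<^sup>2 - 4 * a * c)" using disc p by simp
  then have b: "odd b" by simp
  consider "odd a" | "even a" "odd c" | "even a" "even c" by blast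
  then show ?thesis
  proof cases
    case 1
    show ?thesis by (rule that[of a b c]) (use 1 bac 6 disc in auto)
  next
    case 2
    show ?thesis
    proof (rule that[of c "- b" a])
      show "qform_theta (QForm a b c) z = qform_theta (QForm c (- b) a) z" for z
        by (rule qform_theta_unimodular[where s=0 and t=1 and u="-1" and v=0])
           (simp_all add: algebra_simps)
    qed (use 2 bac 6 disc in \<open>auto simp: mult_ac\<close>)
  next
    case 3
    show ?thesis
    proof (rule that[of "a + b + c" "b + 2 * c" c])
      show "qform_theta (QForm a b c) z = qform_theta (QForm (a + b + c) (b + 2 * c) c) z" for z
        by (rule qform_theta_unimodular[where s=1 and t=0 and u="-1" and v=1])
           (simp_all add: algebra_simps power2_eq_square)
      show "(b + 2 * c)\<^sup>2 - 4 * (a + b + c) * c = - p" using disc by (simp add: algebra_simps power2_eq_square)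
    qed (use 3 b bac 6 in auto)
  qed
qed

section \<open>Ambiguous forms and primality of the discriminant\<close>

lemma qform_pos_defI:
  assumes "a > 0" "b\<^sup>2 - 4 * a * c < 0"
  shows "qform_pos_def (QForm a b c)"
  unfolding qform_pos_def_def
proof (intro allI impI)
  fix x y :: int assume xy: "(x, y) \<noteq> (0, 0)"
  have eq: "4 * a * qform_eval (QForm a b c) x y = (2 * a * x + b * y)\<^sup>2 + (4 * a * c - b\<^sup>2) * y\<^sup>2"
    by (simp add: algebra_simps power2_eq_square)
  have "(2 * a * x + b * y)\<^sup>2 + (4 * a * c - b\<^sup>2) * y\<^sup>2 > 0"
  proof (cases "y = 0")
    case True
    then show ?thesis using xy assms by simp
  next
    case False
    then have "(4 * a * c - b\<^sup>2) * y\<^sup>2 > 0" using assms(2) by (intro mult_pos_pos) auto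
    then show ?thesis by (simp add: add_nonneg_pos)
  qed
  then show "qform_eval (QForm a b c) x y > 0"
    unfolding eq[symmetric] using assms(1) by (simp only: zero_less_mult_iff) auto
qed

lemma qform_primitive_squarefree:
  assumes "squarefree (b\<^sup>2 - 4 * a * c)"
  shows "qform_primitive (QForm a b c)"
proof -
  define g where "g = gcd a (gcd b c)"
  obtain a' b' c' where "a = g * a'" "b = g * b'" "c = g * c'"
    unfolding g_def by (metis dvdE dvd_trans gcd_dvd1 gcd_dvd2)
  then have "b\<^sup>2 - 4 * a * c = g\<^sup>2 * (b'\<^sup>2 - 4 * a' * c')" by (simp add: algebra_simps power2_eq_square)
  then have "is_unit g" using assms unfolding squarefree_def by (metis dvd_triv_left)
  moreover have "g \<ge> 0" by (simp add: g_def)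
  ultimately have "g = 1" by simp
  then show ?thesis by (simp add: g_def)
qed

text \<open>On the boundary |b| = a or a = c the reduction conditions prescribe the sign of
  \<open>b\<close>, so a form and its conjugate can both be reduced there only if they
  coincide.\<close>

lemma non_ambiguous_reduced:
  assumes "QForm a b c \<in> reduced_qforms d" "qform_conj (QForm a b c) \<in> reduced_qforms d"
    "qform_conj (QForm a b c) \<noteq> QForm a b c"
  shows "b \<noteq> 0" "\<bar>b\<bar> < a" "a < c"
  using assms by (auto simp: reduced_qforms_def abs_if split: if_splits)

text \<open>The elementary core of genus theory: if \<open>D\<close> is not a prime congruent to 3
  modulo 4, an explicit reduced form with b = 0, b = a or a = c and leading coefficient above 1
  exists. It is not principal, and by \<open>non_ambiguous_reduced\<close> it cannot be paired with
  a different reduced conjugate.\<close>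

lemma prime_discriminant:
  fixes D :: int
  assumes D: "D > 0" and fd: "fundamental_discriminant (- D)"
    and conj: "\<And>Q. Q \<in> reduced_qforms (- D) \<Longrightarrow> Q \<noteq> principal_qform (- D) \<Longrightarrow>
      qform_conj Q \<in> reduced_qforms (- D) \<and> qform_conj Q \<noteq> Q"
    and R: "R \<in> reduced_qforms (- D)" "R \<noteq> principal_qform (- D)"
  shows "prime D \<and> D mod 4 = 3"
proof -
  have no_ambiguous: False if "a > 1" "b\<^sup>2 - 4 * a * c = - D" "qform_primitive (QForm a b c)"
      "qform_reduced (QForm a b c)" "b = 0 \<or> b = a \<or> a = c" for a b c
  proof -
    have "qform_pos_def (QForm a b c)" using that D by (intro qform_pos_defI) auto
    then have mem: "QForm a b c \<in> reduced_qforms (- D)" using that by (simp add: reduced_qforms_def qforms_def)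
    have "QForm a b c \<noteq> principal_qform (- D)" using that(1) by (simp add: principal_qform_def)
    from conj[OF mem this] have "b \<noteq> 0" "\<bar>b\<bar> < a" "a < c" using non_ambiguous_reduced[OF mem] by blast+
    then show False using that(5) by auto
  qed
  obtain a b c where abc: "R = QForm a b c" by (cases R)
  have abc_ineq: "b \<noteq> 0" "\<bar>b\<bar> < a" "a < c"
    using non_ambiguous_reduced[of a b c "- D"] conj[OF R] R(1) abc by blast+
  have abc_disc: "b\<^sup>2 - 4 * a * c = - D" using R(1) by (simp add: abc reduced_qforms_def qforms_def)
  have D8: "D > 8"
  proof -
    have "b\<^sup>2 < a * a" using abc_ineq power_strict_mono[of "\<bar>b\<bar>" a 2] by (simp add: power2_eq_square)
    moreover have "a * a \<le> a * c" "2 * c \<le> a * c" using abc_ineq by (auto intro!: mult_left_mono mult_right_mono)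
    ultimately show ?thesis using abc_disc abc_ineq by (auto simp: mult.assoc)
  qed
  consider "- D mod 4 = 1" "squarefree D"
    | "- D mod 4 = 0" "squarefree (D div 4)" "(- D div 4) mod 4 = 2 \<or> (- D div 4) mod 4 = 3"
  proof -
    assume 1: "- D mod 4 = 1 \<Longrightarrow> squarefree D \<Longrightarrow> thesis"
      and 2: "- D mod 4 = 0 \<Longrightarrow> squarefree (D div 4) \<Longrightarrow> (- D div 4) mod 4 = 2 \<or> (- D div 4) mod 4 = 3 \<Longrightarrow> thesis"
    have "squarefree (- x) \<longleftrightarrow> squarefree x" for x :: int by (simp add: squarefree_def)
    moreover have "- D div 4 = - (D div 4)" if "- D mod 4 = 0" using that by presburger
    ultimately show thesis using fd 1 2 unfolding fundamental_discriminant_def by auto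
  qed
  then show ?thesis
  proof cases
    case 1
    then have mod4: "D mod 4 = 3" by presburger
    have "prime D"
    proof (rule ccontr)
      assume "\<not> prime D"
      then obtain m0 where m0: "m0 \<ge> 0" "m0 dvd D" "m0 \<noteq> 1" "m0 \<noteq> D" using D8 by (auto simp: prime_int_iff)
      then obtain n0 where n0: "D = m0 * n0" by auto
      have pos: "m0 > 1" "n0 > 1"
      proof -
        have "m0 > 0" "n0 > 0" using D n0 m0(1) by (auto simp: zero_less_mult_iff)
        moreover have "n0 \<noteq> 1" using n0 m0(4) by auto
        ultimately show "m0 > 1" "n0 > 1" using m0(3) by auto
      qed
      have ne: "m0 \<noteq> n0"
      proof
        assume "m0 = n0"
        then have "m0\<^sup>2 dvd D" using n0 by (simp add: power2_eq_square)
        then have "is_unit m0" using 1(2) by (simp add: squarefree_def)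
        then show False using pos by simp
      qed
      define m where "m = min m0 n0"
      define n where "n = max m0 n0"
      have mn: "D = m * n" "1 < m" "m < n" using n0 pos ne by (auto simp: m_def n_def min_def max_def)
      have "(m * n) mod 4 = 3" using mn mod4 by simp
      then have "((m mod 4) * (n mod 4)) mod 4 = 3" by (simp add: mod_mult_eq)
      moreover have "m mod 4 \<in> {0, 1, 2, 3}" "n mod 4 \<in> {0, 1, 2, 3}" by auto
      ultimately have "m mod 4 = 1 \<and> n mod 4 = 3 \<or> m mod 4 = 3 \<and> n mod 4 = 1" by auto
      then have "(m + n) mod 4 = 0" "odd m" by presburger+
      then obtain w where w: "m + n = 4 * w" by auto
      then have n: "n = 4 * w - m" by simp
      have m3: "m \<ge> 3" using \<open>odd m\<close> mn(2) by presburger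
      have prim: "qform_primitive (QForm a b c)" if "b\<^sup>2 - 4 * a * c = - D" for a b c
        using 1(2) by (intro qform_primitive_squarefree) (simp add: that squarefree_def)
      \<comment> \<open>Both (m, m, w) and (w, 2 w - m, w) have discriminant m (m - 4 w) = - m n.
        The first is reduced for m <= w. Otherwise the second is, because m < n forces m < 2
        w.\<close>
      show False
      proof (cases "m \<le> w")
        case True
        have d: "m\<^sup>2 - 4 * m * w = - D" by (simp add: mn(1) n algebra_simps power2_eq_square)
        show False by (rule no_ambiguous[OF mn(2) d prim[OF d]]) (use True mn in auto)
      next
        case False
        have d: "(2 * w - m)\<^sup>2 - 4 * w * w = - D" by (simp add: mn(1) n algebra_simps power2_eq_square)
        have w1: "w > 1" using m3 mn(3) w by linarith
        show False by (rule no_ambiguous[OF w1 d prim[OF d]]) (use False mn w in auto)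
      qed
    qed
    then show ?thesis using mod4 by simp
  next
    case 2
    define n where "n = D div 4"
    have n: "D = 4 * n" using 2(1) by (simp add: n_def) presburger
    then have "n > 2" using D8 by simp
    have "- D div 4 = - n" using n by simp
    then have "n mod 4 = 2 \<or> n mod 4 = 1" using 2(3) by presburger
    \<comment> \<open>The witnesses are 2 x^2 + m y^2 with n = 2 m and 2 x^2 + 2 x y + m y^2 with n
      = 2 m - 1. In both cases \<open>m\<close> is odd, which makes them primitive.\<close>
    then show ?thesis
    proof
      assume "n mod 4 = 2"
      then have "n = 2 * (n div 2)" "odd (n div 2)" by presburger+
      then obtain m where m: "n = 2 * m" "odd m" by blast
      then have "m \<ge> 3" using \<open>n > 2\<close> by presburger
      have "gcd 2 (gcd 0 m) = 1" using m(2) by simp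
      have False
        by (rule no_ambiguous[of 2 0 m]) (use m n \<open>m \<ge> 3\<close> in auto)
      then show ?thesis ..
    next
      assume n1: "n mod 4 = 1"
      define m where "m = (n + 1) div 2"
      have m: "n = 2 * m - 1" "odd m" using n1 unfolding m_def by presburger+
      then have "m \<ge> 3" using \<open>n > 2\<close> by presburger
      have False
        by (rule no_ambiguous[of 2 2 m]) (use m n \<open>m \<ge> 3\<close> in auto)
      then show ?thesis ..
    qed
  qed
qed

section \<open>Logarithms of infinite products and of modular forms\<close>

lemma summable_powr_geometric:
  fixes x \<alpha> :: real
  assumes x: "0 \<le> x" "x < 1"
  shows "summable (\<lambda>n. real n powr \<alpha> * x ^ n)"
proof (cases "x = 0")
  case True
  then show ?thesis by (intro summable_finite[of "{0}"]) auto
next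
  case False
  \<comment> \<open>Factor x = u y with both factors below 1: the powers of \<open>u\<close> absorb
    the polynomial, the powers of \<open>y\<close> are summed.\<close>
  define y where "y = (1 + x) / 2"
  define u where "u = x / y"
  have y: "0 < y" "y < 1" and u: "0 < u" "u < 1" using x False by (auto simp: y_def u_def field_simps)
  have "(\<lambda>n. real n powr \<alpha> * u powr real n) \<longlonglongrightarrow> 0"
    using u by real_asymp
  then have "(\<lambda>n. real n powr \<alpha> * u ^ n) \<longlonglongrightarrow> 0"
    using u by (simp add: powr_realpow)
  then have "Bseq (\<lambda>n. real n powr \<alpha> * u ^ n)" by (intro convergent_imp_Bseq convergentI)
  then obtain K where K: "\<And>n. norm (real n powr \<alpha> * u ^ n) \<le> K" unfolding Bseq_def by blast
  show ?thesis
  proof (rule summable_comparison_test'[where N=0])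
    show "summable (\<lambda>n. K * y ^ n)" using y by (intro summable_mult summable_geometric) auto
    fix n
    have "real n powr \<alpha> * x ^ n = real n powr \<alpha> * u ^ n * y ^ n"
      using y by (simp add: u_def power_divide)
    also have "norm \<dots> \<le> K * y ^ n"
      using mult_right_mono[OF K[of n], of "y ^ n"] y by (simp add: abs_mult)
    finally show "norm (real n powr \<alpha> * x ^ n) \<le> K * y ^ n" .
  qed
qed

text \<open>Strong induction in place of Moebius inversion. The divisor sum contributes at most half
  of \<open>A * 4 ^ n\<close> because 2^n <= 4^n / 2, and the proper divisors contribute at most a
  third by the geometric series.\<close>

lemma divisor_sum_bound_imp_bound:
  fixes c :: "nat \<Rightarrow> real"
  assumes A: "A \<ge> 0" and b: "\<And>n. n \<ge> 1 \<Longrightarrow> \<bar>\<Sum>d | d dvd n. c d\<bar> \<le> A * 2 ^ n"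
    and n: "n \<ge> 1"
  shows "\<bar>c n\<bar> \<le> A * 4 ^ n"
  using n
proof (induction n rule: less_induct)
  case (less n)
  have geo: "3 * (\<Sum>d<n. 4 ^ d :: real) = 4 ^ n - 1" for n by (induction n) auto
  have fin: "finite {d. d dvd n}" using less.prems by simp
  have "(\<Sum>d | d dvd n. c d) = c n + (\<Sum>d\<in>{d. d dvd n} - {n}. c d)"
    using fin by (subst sum.remove[of _ n]) auto
  then have "\<bar>c n\<bar> \<le> \<bar>\<Sum>d | d dvd n. c d\<bar> + \<bar>\<Sum>d\<in>{d. d dvd n} - {n}. c d\<bar>" by linarith
  also have "\<bar>\<Sum>d\<in>{d. d dvd n} - {n}. c d\<bar> \<le> (\<Sum>d\<in>{d. d dvd n} - {n}. \<bar>c d\<bar>)" by (rule sum_abs)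
  also have "\<dots> \<le> (\<Sum>d\<in>{d. d dvd n} - {n}. A * 4 ^ d)"
  proof (rule sum_mono)
    fix d assume d: "d \<in> {d. d dvd n} - {n}"
    then have "d \<le> n" "d \<noteq> 0" using less.prems by (auto dest: dvd_imp_le)
    with d show "\<bar>c d\<bar> \<le> A * 4 ^ d" by (intro less.IH) auto
  qed
  also have "\<dots> \<le> (\<Sum>d<n. A * 4 ^ d)"
  proof (rule sum_mono2)
    show "{d. d dvd n} - {n} \<subseteq> {..<n}" using less.prems by (auto dest: dvd_imp_le simp: le_less)
  qed (use A in auto)
  also have "\<dots> = A * (\<Sum>d<n. 4 ^ d)" by (simp add: sum_distrib_left)
  also have "\<dots> \<le> A * (4 ^ n / 3)" using A geo[of n] by (intro mult_left_mono) auto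
  also have "\<bar>\<Sum>d | d dvd n. c d\<bar> \<le> A * (4 ^ n / 2)"
  proof -
    obtain k where k: "n = Suc k" using less.prems by (cases n) auto
    have "(2::real) ^ k \<le> 4 ^ k" by (intro power_mono) auto
    then have "(2::real) ^ n \<le> 4 ^ n / 2" by (simp add: k)
    then show ?thesis using b[OF less.prems] mult_left_mono[OF _ A] by (meson order_trans)
  qed
  finally have "\<bar>c n\<bar> \<le> A * (4 ^ n / 2) + A * (4 ^ n / 3)" by simp
  also have "\<dots> \<le> A * 4 ^ n"
  proof -
    have "A * 4 ^ n \<ge> 0" using A by simp
    then show ?thesis by simp
  qed
  finally show ?case .
qed

text \<open>Expand each logarithm as a power series in w^d and regroup the pairs (d, m) by N = d m.
  The bound 1/8 beats the growth 4^n: the term at d = i + 1 and m is at most 4 A 2^(-i) 8^(-m), so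
  the double series converges absolutely.\<close>

lemma prod_powi_eq_exp_divisor_sum:
  fixes c :: "nat \<Rightarrow> int" and w :: complex
  assumes w: "norm w \<le> 1 / 8" and A: "A \<ge> 0" and c: "\<And>n. n \<ge> 1 \<Longrightarrow> \<bar>real_of_int (c n)\<bar> \<le> A * 4 ^ n"
  shows "(\<Prod>n. (1 - w ^ Suc n) powi c (Suc n)) =
    exp (- (\<Sum>\<^sub>\<infinity>N::nat. of_real ((\<Sum>d | d dvd N. real d * of_int (c d)) / real N) * w ^ N))"
proof -
  \<comment> \<open>The index \<open>i\<close> stands for d = i + 1. Division by zero makes the
    terms at m = 0 and at N = 0 vanish, so power series can start at 0.\<close>
  define G where "G = (\<lambda>(i::nat) (m::nat). - of_int (c (Suc i)) * w ^ (Suc i * m) / of_nat m)"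
  define H where "H = (\<lambda>(N::nat) (d::nat). - of_int (c d) * w ^ N * of_nat d / of_nat N)"
  have normG: "norm (G i m) \<le> (4 * A * (1 / 2) ^ i) * (1 / 8) ^ m" for i m
  proof (cases "m = 0")
    case True then show ?thesis using A by (simp add: G_def)
  next
    case False
    have "i + m \<le> Suc i * m" using False by (cases m) auto
    then have "norm w ^ (Suc i * m) \<le> norm w ^ (i + m)" using w by (intro power_decreasing) auto
    also have "\<dots> \<le> (1 / 8) ^ (i + m)" using w by (intro power_mono) auto
    finally have 1: "norm w ^ (Suc i * m) \<le> (1 / 8) ^ (i + m)" .
    have "norm (G i m) = \<bar>real_of_int (c (Suc i))\<bar> * norm w ^ (Suc i * m) / real m"
      by (simp add: G_def norm_mult norm_divide norm_power)
    also have "\<dots> \<le> \<bar>real_of_int (c (Suc i))\<bar> * norm w ^ (Suc i * m) / 1"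
      using False by (intro divide_left_mono) auto
    also have "\<dots> \<le> A * 4 ^ Suc i * (1 / 8) ^ (i + m)"
      using c[of "Suc i"] 1 A by (simp only: div_by_1, intro mult_mono) auto
    also have "\<dots> = 4 * A * (4 ^ i * (1 / 8) ^ i) * (1 / 8) ^ m" by (simp add: power_add)
    also have "(4::real) ^ i * (1 / 8) ^ i = (1 / 2) ^ i" by (simp flip: power_mult_distrib)
    finally show ?thesis .
  qed
  have summable_geo: "(\<lambda>i::nat. K * x ^ i) summable_on UNIV" if "K \<ge> 0" "0 \<le> x" "x < 1" for K x :: real
  proof (subst summable_on_UNIV_nonneg_real_iff)
    show "summable (\<lambda>i. K * x ^ i)" using that by (intro summable_mult summable_geometric) auto
  qed (use that in auto)
  have absG: "(\<lambda>p. norm (case p of (i, m) \<Rightarrow> G i m)) summable_on UNIV"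
  proof (rule summable_on_comparison_test)
    show "(\<lambda>(i, m). (4 * A * (1 / 2) ^ i) * (1 / 8) ^ m) summable_on (UNIV :: (nat \<times> nat) set)"
      using A summable_geo[of 1 "1/8"] by (intro summable_on_product_nonneg summable_geo) auto
  qed (use normG in auto)
  then have sumG: "(\<lambda>(i, m). G i m) summable_on UNIV" by (rule abs_summable_summable)
  have inner: "(\<Sum>\<^sub>\<infinity>m. G i m) = of_int (c (Suc i)) * Ln (1 - w ^ Suc i)" for i
  proof -
    have "(\<lambda>m. G i m) summable_on UNIV"
    proof (rule abs_summable_summable, rule summable_on_comparison_test)
      show "(\<lambda>m. (4 * A * (1 / 2) ^ i) * (1 / 8) ^ m) summable_on (UNIV :: nat set)"
        using A by (intro summable_geo) auto
    qed (use normG in auto)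
    then have "(\<lambda>m. G i m) sums (\<Sum>\<^sub>\<infinity>m. G i m)" by (intro has_sum_imp_sums has_sum_infsum)
    moreover have "norm (w ^ Suc i) < 1"
    proof -
      have "norm w ^ Suc i \<le> norm w ^ 1" using w by (intro power_decreasing) auto
      then show ?thesis using w by (simp add: norm_power del: power_Suc)
    qed
    then have "(\<lambda>m. of_int (c (Suc i)) * (- ((- (- (w ^ Suc i))) ^ m) / of_nat m)) sums
        (of_int (c (Suc i)) * Ln (1 + - (w ^ Suc i)))"
      by (intro sums_mult Ln_series') simp
    moreover have "(\<lambda>m. of_int (c (Suc i)) * (- ((- (- (w ^ Suc i))) ^ m) / of_nat m)) = G i"
      unfolding G_def prod.case power_mult by (simp del: power_Suc)
    ultimately show ?thesis using sums_unique2 by fastforce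
  qed
  have bij: "bij_betw (\<lambda>(i, m). (Suc i * m, Suc i)) (UNIV \<times> {1..}) (SIGMA N:{1..}. {d. d dvd N})"
  proof (rule bij_betw_byWitness[where f'="\<lambda>(N, d). (d - 1, N div d)"])
    show "\<forall>p\<in>UNIV \<times> {1..}. (case case p of (i, m) \<Rightarrow> (Suc i * m, Suc i) of (N, d) \<Rightarrow> (d - 1, N div d)) = p"
      by (auto simp del: mult_Suc)
    show "\<forall>q\<in>(SIGMA N:{1..}. {d. d dvd N}). (case case q of (N, d) \<Rightarrow> (d - 1, N div d) of (i, m) \<Rightarrow> (Suc i * m, Suc i)) = q"
    proof (clarsimp simp del: mult_Suc)
      fix N d :: nat assume "Suc 0 \<le> N" "d dvd N"
      then have "d > 0" by (auto intro: Nat.gr0I)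
      then show "Suc (d - Suc 0) * (N div d) = N \<and> Suc (d - Suc 0) = d" using \<open>d dvd N\<close> by simp
    qed
    show "(\<lambda>(i, m). (Suc i * m, Suc i)) ` (UNIV \<times> {1..}) \<subseteq> (SIGMA N:{1..}. {d. d dvd N})"
      by (auto simp del: mult_Suc)
    show "(\<lambda>(N :: nat, d). (d - 1, N div d)) ` (SIGMA N:{1..}. {d. d dvd N}) \<subseteq> UNIV \<times> {1..}"
    proof -
      have "1 \<le> N div d" if "1 \<le> N" "d dvd N" for N d :: nat
      proof -
        have "0 < d \<and> d \<le> N" using that by (auto intro: Nat.gr0I dvd_imp_le)
        then show ?thesis by (simp add: Suc_le_eq div_greater_zero_iff)
      qed
      then show ?thesis by (auto simp del: One_nat_def)
    qed
  qed
  have HG: "H (Suc i * m) (Suc i) = G i m" for i m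
    unfolding H_def G_def of_nat_mult by (simp del: of_nat_Suc power_Suc mult_Suc)
  have nz: "1 - w ^ Suc i \<noteq> 0" for i
  proof
    assume "1 - w ^ Suc i = 0"
    then have "norm w ^ Suc i = 1" by (metis eq_iff_diff_eq_0 norm_one norm_power)
    moreover have "norm w ^ Suc i \<le> norm w ^ 1" using w by (intro power_decreasing) auto
    ultimately show False using w by simp
  qed
  have "(\<lambda>i. \<Sum>\<^sub>\<infinity>m. G i m) summable_on UNIV"
    using summable_on_Sigma_banach[of G UNIV "\<lambda>_. UNIV"] sumG by simp
  then have "(\<lambda>i. \<Sum>\<^sub>\<infinity>m. G i m) sums (\<Sum>\<^sub>\<infinity>i. \<Sum>\<^sub>\<infinity>m. G i m)"
    by (intro has_sum_imp_sums has_sum_infsum)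
  then have "(\<Prod>i. exp (of_int (c (Suc i)) * Ln (1 - w ^ Suc i))) = exp (\<Sum>\<^sub>\<infinity>i. \<Sum>\<^sub>\<infinity>m. G i m)"
    unfolding inner by (subst prodinf_exp) (auto simp: sums_iff)
  \<comment> \<open>The exponents are integers, so exponentiating the principal logarithms returns
    the factors whatever their branch.\<close>
  also have "(\<lambda>i. exp (of_int (c (Suc i)) * Ln (1 - w ^ Suc i))) = (\<lambda>i. (1 - w ^ Suc i) powi c (Suc i))"
    using nz by (simp add: exp_power_int[symmetric] fun_eq_iff)
  also have "(\<Sum>\<^sub>\<infinity>i. \<Sum>\<^sub>\<infinity>m. G i m) = (\<Sum>\<^sub>\<infinity>(i, m). G i m)"
    using infsum_Sigma'_banach[of G UNIV "\<lambda>_. UNIV"] sumG by simp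
  also have "\<dots> = (\<Sum>\<^sub>\<infinity>(i, m)\<in>UNIV \<times> {1..}. G i m)"
    by (rule infsum_cong_neutral) (auto simp: G_def Suc_le_eq)
  also have "\<dots> = (\<Sum>\<^sub>\<infinity>p\<in>UNIV \<times> {1..}. case (case p of (i, m) \<Rightarrow> (Suc i * m, Suc i)) of (N, d) \<Rightarrow> H N d)"
    by (rule infsum_cong) (use HG in auto)
  also have "\<dots> = (\<Sum>\<^sub>\<infinity>(N, d)\<in>(SIGMA N:{1..}. {d. d dvd N}). H N d)"
    by (rule infsum_reindex_bij_betw[OF bij])
  also have "\<dots> = (\<Sum>\<^sub>\<infinity>N\<in>{1..}. \<Sum>\<^sub>\<infinity>d\<in>{d. d dvd N}. H N d)"
  proof (rule infsum_Sigma'_banach[symmetric])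
    have "(\<lambda>p. case p of (i, m) \<Rightarrow> G i m) summable_on (UNIV \<times> {1..})"
      using sumG by (rule summable_on_subset_banach) auto
    also have "?this \<longleftrightarrow> (\<lambda>p. case (case p of (i, m) \<Rightarrow> (Suc i * m, Suc i)) of (N, d) \<Rightarrow> H N d) summable_on (UNIV \<times> {1..})"
      by (rule summable_on_cong) (use HG in auto)
    also have "\<dots> \<longleftrightarrow> (\<lambda>(N, d). H N d) summable_on (SIGMA N:{1..}. {d. d dvd N})"
      by (rule summable_on_reindex_bij_betw[OF bij])
    finally show "(\<lambda>(N, d). H N d) summable_on (SIGMA N:{1..}. {d. d dvd N})" .
  qed
  also have "\<dots> = (\<Sum>\<^sub>\<infinity>N. - (of_real ((\<Sum>d | d dvd N. real d * of_int (c d)) / real N) * w ^ N))"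
  proof (rule infsum_cong_neutral)
    fix N :: nat assume "N \<in> {1..} \<inter> UNIV"
    then have "finite {d. d dvd N}" by simp
    then show "(\<Sum>\<^sub>\<infinity>d\<in>{d. d dvd N}. H N d) = - (of_real ((\<Sum>d | d dvd N. real d * of_int (c d)) / real N) * w ^ N)"
      by (simp add: H_def sum_negf sum_distrib_left sum_divide_distrib sum_distrib_right mult_ac)
  qed (auto simp: Suc_le_eq)
  also have "\<dots> = - (\<Sum>\<^sub>\<infinity>N. of_real ((\<Sum>d | d dvd N. real d * of_int (c d)) / real N) * w ^ N)"
    by (rule infsum_uminus)
  finally show ?thesis .
qed

section \<open>The norm to level 1 and its logarithm\<close>

text \<open>Describes how the inversion z to -1 / z permutes the factors F((z + j) / p) of the norm
  with 0 < j < p.\<close>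

lemma negative_inverse_permutation:
  fixes p :: nat
  assumes "prime p"
  obtains \<sigma> where "bij_betw \<sigma> {1..<p} {1..<p}"
    "\<And>j. j \<in> {1..<p} \<Longrightarrow> [int j * int (\<sigma> j) = - 1] (mod int p)"
proof -
  have "\<exists>k\<in>{1..<p}. [int j * int k = - 1] (mod int p)" if j: "j \<in> {1..<p}" for j
  proof -
    have "\<not> p dvd j" using j by (auto dest: dvd_imp_le)
    then have "coprime (int j) (int p)" using assms
      by (metis coprime_commute coprime_int_iff prime_imp_coprime)
    then obtain x where x: "[int j * x = 1] (mod int p)" using cong_solve_coprime_int by blast
    define k where "k = nat ((- x) mod int p)"
    have p: "p > 1" using assms prime_gt_1_nat by blast
    have k: "int k = (- x) mod int p" "k < p" using p by (auto simp: k_def nat_less_iff)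
    have "[int k = - x] (mod int p)" by (simp add: k cong_def)
    then have "[int j * int k = int j * (- x)] (mod int p)" by (rule cong_scalar_left)
    moreover have "[int j * (- x) = - 1] (mod int p)" using cong_scalar_left[OF x, of "- 1"] by (simp add: mult_ac)
    ultimately have *: "[int j * int k = - 1] (mod int p)" by (rule cong_trans)
    have "k \<noteq> 0"
    proof
      assume "k = 0"
      then have "int p dvd 1" using * by (simp add: cong_iff_dvd_diff)
      then show False using p by simp
    qed
    then show ?thesis using * k(2) by (intro bexI[of _ k]) auto
  qed
  then obtain \<sigma> where \<sigma>: "\<And>j. j \<in> {1..<p} \<Longrightarrow> \<sigma> j \<in> {1..<p} \<and> [int j * int (\<sigma> j) = - 1] (mod int p)"
    by metis
  have "inj_on \<sigma> {1..<p}"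
  proof (rule inj_onI)
    fix i j assume ij: "i \<in> {1..<p}" "j \<in> {1..<p}" "\<sigma> i = \<sigma> j"
    have "\<not> p dvd \<sigma> j" using \<sigma>[OF ij(2)] by (auto dest: dvd_imp_le)
    then have "coprime (int (\<sigma> j)) (int p)" using assms
      by (metis coprime_commute coprime_int_iff prime_imp_coprime)
    moreover have "[int i * int (\<sigma> j) = int j * int (\<sigma> j)] (mod int p)"
      using \<sigma>[OF ij(1)] \<sigma>[OF ij(2)] ij(3) by (metis cong_sym cong_trans)
    ultimately have "[int i = int j] (mod int p)" by (simp add: cong_mult_rcancel)
    then show "i = j" using ij by (simp add: cong_int_iff cong_def)
  qed
  moreover have "\<sigma> ` {1..<p} \<subseteq> {1..<p}" using \<sigma> by blast
  ultimately have "bij_betw \<sigma> {1..<p} {1..<p}"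
    by (simp add: bij_betw_def card_image card_subset_eq)
  then show ?thesis using that \<sigma> by blast
qed

text \<open>The product over the cosets of the level \<open>p\<close> group is a modular form of level 1, weight \<open>p + 1\<close>
  and order 2 at infinity, and \<open>\<Lambda>\<close> is a logarithm of it. Comparing the two sides of the transformation
  under \<open>z \<mapsto> - 1 / z\<close> at the elliptic points \<open>\<i>\<close> and \<open>exp (\<i> * pi / 3)\<close> is the valence formula
  \<open>(p + 1) / 12 = 2\<close>.\<close>

lemma logarithm_of_level_form:
  fixes p :: nat and L F :: "complex \<Rightarrow> complex" and g :: "nat \<Rightarrow> complex"
  assumes p: "p > 0"
    and holL: "L holomorphic_on {z. Im z > 0}"
    and per: "\<And>z. Im z > 0 \<Longrightarrow> L (z + 1) = L z + 2 * of_real pi * \<i>"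
    and expL: "\<And>z. Im z > 0 \<Longrightarrow> exp (L z) = F z"
    and F0: "\<And>t. t > 0 \<Longrightarrow> F (\<i> * of_real t / of_nat p) = of_real (sqrt p / t) * F (\<i> * of_real (1 / t))"
    and bij: "bij_betw \<sigma> {1..<p} {1..<p}"
    and F1: "\<And>j t. j \<in> {1..<p} \<Longrightarrow> t > 0 \<Longrightarrow>
      F ((of_nat j + \<i> * of_real t) / of_nat p) = g j / of_real t * F ((of_nat (\<sigma> j) + \<i> * of_real (1 / t)) / of_nat p)"
  shows "p = 23"
proof -
  define H where "H = {z::complex. Im z > 0}"
  have H: "open H" "convex H" "connected H"
    unfolding H_def by (auto simp: open_halfspace_Im_gt convex_halfspace_Im_gt intro: convex_connected)
  define \<Lambda> where "\<Lambda> = (\<lambda>z. L z + (\<Sum>j<p. L ((z + of_nat j) / of_nat p)))"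
  have Im_pos: "Im ((z + of_nat j) / of_nat p) > 0" if "Im z > 0" for z j
    using that p by simp
  \<comment> \<open>Translation by 1 moves each factor (z + j) / p to the next, so the sum changes
    by \<open>f p - f 0\<close>, one period of \<open>L\<close>. With the period of
    \<open>L z\<close> itself this makes two periods, the order 2 at infinity.\<close>
  have \<Lambda>_per: "\<Lambda> (z + 1) = \<Lambda> z + 4 * of_real pi * \<i>" if z: "Im z > 0" for z
  proof -
    define f where "f = (\<lambda>j::nat. L ((z + of_nat j) / of_nat p))"
    have "(\<Sum>j<p. L ((z + 1 + of_nat j) / of_nat p)) = (\<Sum>j<p. f (Suc j))"
      by (simp add: f_def add_ac)
    also have "\<dots> = (\<Sum>j<p. f j) + f p - f 0"
      using sum.lessThan_Suc_shift[of f p] sum.lessThan_Suc[of f p] by simp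
    also have "f p = f 0 + 2 * of_real pi * \<i>"
    proof -
      have "(z + of_nat p) / of_nat p = (z + of_nat 0) / of_nat p + 1" using p by (simp add: field_simps)
      then show ?thesis unfolding f_def using per[OF Im_pos[OF z, of 0]] by simp
    qed
    finally show ?thesis by (simp add: \<Lambda>_def f_def per[OF z])
  qed
  have hol\<Lambda>: "\<Lambda> holomorphic_on H"
  proof -
    have "(L \<circ> (\<lambda>z. (z + of_nat j) / of_nat p)) holomorphic_on H" for j
      by (rule holomorphic_on_compose_gen[OF _ holL])
         (use p Im_pos in \<open>auto intro!: holomorphic_intros simp: H_def\<close>)
    then show ?thesis unfolding \<Lambda>_def using holL
      by (auto intro!: holomorphic_on_add holomorphic_on_sum simp: o_def H_def)
  qed
  have exp\<Lambda>: "exp (\<Lambda> (\<i> * of_real t)) = F (\<i> * of_real t) * F (\<i> * of_real t / of_nat p) *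
      (\<Prod>j\<in>{1..<p}. F ((of_nat j + \<i> * of_real t) / of_nat p))" if t: "t > 0" for t
  proof -
    have "exp (\<Lambda> (\<i> * of_real t)) = F (\<i> * of_real t) * (\<Prod>j<p. F ((\<i> * of_real t + of_nat j) / of_nat p))"
      unfolding \<Lambda>_def exp_add using t p by (simp add: exp_sum expL)
    also have "{..<p} = insert 0 {1..<p}" using p by auto
    finally show ?thesis by (simp add: add.commute)
  qed
  define K where "K = (\<Prod>j\<in>{1..<p}. g j)"
  \<comment> \<open>The inversion exchanges the factors at z and z / p, by \<open>F0\<close> in both
    directions, and permutes the others by \<open>\<sigma>\<close>. The square roots of
    \<open>p\<close> cancel and the powers of \<open>t\<close> add up to the weight p + 1.\<close>
  have rel: "exp (\<Lambda> (\<i> * of_real t)) = K / of_real t ^ (p + 1) * exp (\<Lambda> (\<i> * of_real (1 / t)))" if t: "t > 0" for t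
  proof -
    have 1: "F (\<i> * of_real t) = of_real (sqrt p / (p * t)) * F (\<i> * of_real (1 / t) / of_nat p)"
      using F0[of "p * t"] p t by (simp add: field_simps)
    have "(\<Prod>j\<in>{1..<p}. F ((of_nat j + \<i> * of_real t) / of_nat p)) =
        (\<Prod>j\<in>{1..<p}. g j / of_real t * F ((of_nat (\<sigma> j) + \<i> * of_real (1 / t)) / of_nat p))"
      using t by (intro prod.cong F1) auto
    also have "\<dots> = K / of_real t ^ (p - 1) * (\<Prod>j\<in>{1..<p}. F ((of_nat (\<sigma> j) + \<i> * of_real (1 / t)) / of_nat p))"
      by (simp add: prod.distrib prod_dividef K_def)
    also have "(\<Prod>j\<in>{1..<p}. F ((of_nat (\<sigma> j) + \<i> * of_real (1 / t)) / of_nat p)) =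
        (\<Prod>j\<in>{1..<p}. F ((of_nat j + \<i> * of_real (1 / t)) / of_nat p))"
      by (rule prod.reindex_bij_betw[OF bij])
    finally have 2: "(\<Prod>j\<in>{1..<p}. F ((of_nat j + \<i> * of_real t) / of_nat p)) =
        K / of_real t ^ (p - 1) * (\<Prod>j\<in>{1..<p}. F ((of_nat j + \<i> * of_real (1 / t)) / of_nat p))" .
    have "t ^ (p + 1) = t ^ (p - 1) * (t * t)" using p by (cases p) simp_all
    moreover have "sqrt p * sqrt p = real p" by simp
    ultimately have c_real: "sqrt p / (p * t) * (sqrt p / t) / t ^ (p - 1) = 1 / t ^ (p + 1)"
      using p t by (simp only: times_divide_times_eq) simp
    have c: "complex_of_real (sqrt p / (p * t)) * of_real (sqrt p / t) * (K / of_real t ^ (p - 1)) = K / of_real t ^ (p + 1)"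
    proof -
      have *: "complex_of_real A * of_real B * (K / of_real T) = of_real (A * B / T) * K" for A B T by simp
      then show ?thesis unfolding of_real_power[symmetric] * c_real by simp
    qed
    show ?thesis
      unfolding exp\<Lambda>[OF t] exp\<Lambda>[OF divide_pos_pos[OF zero_less_one t]] 1 2 F0[OF t] c[symmetric] by (simp only: mult_ac)
  qed
  \<comment> \<open>By \<open>rel\<close>, \<open>exp \<circ> h\<close> is constant on the imaginary
    axis and hence on \<open>H\<close>; its derivative vanishes, so \<open>h\<close> itself is
    constant. Constancy of \<open>h\<close> retains the multiples of 2 pi i that the exponential
    forgets, and these carry the order at infinity.\<close>
  define h where "h = (\<lambda>z. \<Lambda> (- 1 / z) - \<Lambda> z - of_nat (p + 1) * Ln z)"
  have inv_H: "- 1 / z \<in> H" if "z \<in> H" for z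
  proof -
    have "Im (- 1 / z) = Im z / (norm z)\<^sup>2" by (simp add: Im_divide cmod_power2)
    moreover have "z \<noteq> 0" using that by (auto simp: H_def)
    ultimately show ?thesis using that by (simp add: H_def)
  qed
  have holh: "h holomorphic_on H"
  proof -
    have "(\<lambda>z. - 1 / z) holomorphic_on H" by (auto intro!: holomorphic_intros simp: H_def)
    then have "(\<Lambda> \<circ> (\<lambda>z. - 1 / z)) holomorphic_on H"
      using inv_H by (intro holomorphic_on_compose_gen[OF _ hol\<Lambda>]) auto
    moreover have "Ln holomorphic_on H" by (rule holomorphic_on_Ln) (auto simp: H_def complex_nonpos_Reals_iff)
    ultimately show ?thesis
      unfolding h_def using hol\<Lambda> by (intro holomorphic_on_diff holomorphic_on_mult) (auto simp: o_def)
  qed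
  define c where "c = K / \<i> ^ (p + 1)"
  have h_axis: "exp (h (\<i> * of_real y)) = c" if y: "y > 0" for y
  proof -
    have "- 1 / (\<i> * of_real y) = \<i> * of_real (1 / y)" using y by (simp add: field_simps)
    moreover have "exp (of_nat (p + 1) * Ln (\<i> * of_real y)) = (\<i> * of_real y) ^ (p + 1)"
      using y by (simp only: exp_of_nat_mult exp_Ln) simp
    moreover have "exp (\<Lambda> (\<i> * of_real (1 / y))) = K * of_real y ^ (p + 1) * exp (\<Lambda> (\<i> * of_real y))"
      using rel[of "1 / y"] y by (simp add: power_divide)
    ultimately show ?thesis
      using y unfolding h_def exp_diff c_def by (simp add: power_mult_distrib)
  qed
  have exp_h: "exp (h z) - c = 0" if "z \<in> H" for z
  proof (rule analytic_continuation[where f="\<lambda>z. exp (h z) - c" and S=H and U="(\<lambda>y. \<i> * of_real y) ` {0<..<2}" and \<xi>="\<i> * of_real 1"])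
    show "(\<lambda>z. exp (h z) - c) holomorphic_on H" by (intro holomorphic_intros holh)
    have "(1::real) islimpt {0<..<2}" by (rule interior_limit_point) (simp add: interior_open)
    then show "\<i> * complex_of_real 1 islimpt (\<lambda>y. \<i> * of_real y) ` {0<..<2}"
    proof (rule islimpt_isCont_image)
      show "\<forall>\<^sub>F y in at (1::real). \<i> * complex_of_real y \<noteq> \<i> * complex_of_real 1"
        using eventually_neq_at_within[of "1::real" 1 UNIV] by eventually_elim simp
    qed (intro continuous_intros)
    show "exp (h z) - c = 0" if "z \<in> (\<lambda>y. \<i> * of_real y) ` {0<..<2}" for z
      using that h_axis by auto
  qed (use H that in \<open>auto simp: H_def\<close>)
  have "\<exists>d. \<forall>z\<in>H. h z = d"
  proof (rule has_field_derivative_zero_constant[OF H(2)])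
    fix z assume z: "z \<in> H"
    have d: "(h has_field_derivative deriv h z) (at z)" by (rule holomorphic_derivI[OF holh H(1) z])
    then have "((\<lambda>z. exp (h z)) has_field_derivative exp (h z) * deriv h z) (at z)"
      by (auto intro!: derivative_eq_intros)
    moreover have "((\<lambda>z. exp (h z)) has_field_derivative 0) (at z)"
    proof (rule has_field_derivative_transform_within_open[OF _ H(1) z])
      show "((\<lambda>_. c) has_field_derivative 0) (at z)" by (rule DERIV_const)
    qed (use exp_h in auto)
    ultimately have "exp (h z) * deriv h z = 0" by (rule DERIV_unique)
    then show "(h has_field_derivative 0) (at z within H)"
      using d by (auto intro: has_field_derivative_at_within)
  qed
  then obtain d where d: "\<And>z. z \<in> H \<Longrightarrow> h z = d" by blast
  \<comment> \<open>At the fixed point i the terms in \<open>\<Lambda>\<close> cancel and only the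
    logarithm i pi / 2 is left. At \<open>\<rho>\<close> the inversion gives \<rho> - 1, so a period
    of \<open>\<Lambda>\<close> enters next to the logarithm i pi / 3. Equality of the two values
    reads (p + 1) (1/2 - 1/3) = 4.\<close>
  have hi: "h \<i> = - of_nat (p + 1) * (\<i> * of_real pi / 2)"
    by (simp add: h_def algebra_simps)
  define \<rho> where "\<rho> = exp (\<i> * of_real (pi / 3))"
  have \<rho>: "\<rho> = Complex (1 / 2) (sqrt 3 / 2)"
  proof -
    have "\<rho> = cis (pi / 3)" by (simp add: \<rho>_def cis_conv_exp)
    then show ?thesis by (simp add: complex_eq_iff cos_60 sin_60)
  qed
  have "- 1 / \<rho> + 1 = \<rho>"
  proof -
    have "\<rho> * \<rho> = \<rho> - 1" by (simp add: \<rho> complex_eq_iff)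
    moreover have "\<rho> \<noteq> 0" by (simp add: \<rho>_def)
    ultimately show ?thesis by (simp add: field_simps)
  qed
  moreover have \<rho>H: "\<rho> \<in> H" by (simp add: \<rho> H_def)
  ultimately have "\<Lambda> \<rho> = \<Lambda> (- 1 / \<rho>) + 4 * of_real pi * \<i>"
    using \<Lambda>_per[of "- 1 / \<rho>"] inv_H[OF \<rho>H] by (simp add: H_def)
  moreover have "Ln \<rho> = \<i> * of_real (pi / 3)" unfolding \<rho>_def by (rule Ln_exp) auto
  ultimately have h\<rho>: "h \<rho> = - (4 * of_real pi * \<i>) - of_nat (p + 1) * (\<i> * of_real (pi / 3))"
    by (simp add: h_def)
  have "h \<i> = h \<rho>" using d \<rho>H by (simp add: H_def)
  then have "Im (h \<i>) = Im (h \<rho>)" by simp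
  then have *: "(- 1 - real p) * pi = - (8 * pi) - (1 + real p) * pi * 2 / 3" unfolding hi h\<rho> by simp
  define x where "x = (1 + real p) * pi"
  have "(- 1 - real p) * pi = - x" by (simp add: x_def algebra_simps)
  then have "x = 24 * pi" using * unfolding x_def[symmetric] by simp
  then have "1 + real p = 24" by (simp add: x_def)
  then show ?thesis by simp
qed

section \<open>Theta differences of prime level under a growth bound\<close>

text \<open>The multiplier \<open>gauss_sum p j\<close> is now free of the form: \<open>a\<close> is
  a square modulo \<open>p\<close>, so the twist by \<open>a\<close> disappears. This uniformity
  lets the laws pass to differences.\<close>

lemma qform_theta_prime_level:
  fixes a b c p :: int
  assumes p: "prime p" "p mod 4 = 3" and a: "odd a" "0 < a" "a < p" and disc: "b\<^sup>2 - 4 * a * c = - p"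
  shows "qform_theta (QForm a b c) holomorphic_on {z. Im z > 0}"
    and "\<And>t. t > 0 \<Longrightarrow> qform_theta (QForm a b c) (\<i> * of_real t / of_int p) =
      of_real (sqrt (of_int p) / t) * qform_theta (QForm a b c) (\<i> * of_real (1 / t))"
    and "\<And>t j j'. t > 0 \<Longrightarrow> [j * j' = - 1] (mod p) \<Longrightarrow>
      qform_theta (QForm a b c) ((of_int j + \<i> * of_real t) / of_int p) =
      gauss_sum p j / of_real (t * sqrt (of_int p)) *
      qform_theta (QForm a b c) ((of_int j' + \<i> * of_real (1 / t)) / of_int p)"
proof -
  have p0: "p > 0" using p(1) by (rule prime_gt_0_int)
  have "odd p" using p(2) by presburger
  then obtain \<beta> \<gamma> where det: "4 * a * \<gamma> = 1 + p * \<beta>\<^sup>2"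
    and eq: "\<And>z. qform_theta (QForm a b c) z = qform_theta (QForm a (p * \<beta>) (p * \<gamma>)) z"
    using qform_theta_level_form[OF p(1) a(2,3) _ disc] by blast
  obtain r where r: "coprime r p" "[a = r\<^sup>2] (mod p)"
    using leading_coeff_QuadRes[OF p a disc] by blast
  show "qform_theta (QForm a b c) holomorphic_on {z. Im z > 0}"
    using a(2) disc p0 by (intro holomorphic_qform_theta) auto
  show "qform_theta (QForm a b c) (\<i> * of_real t / of_int p) =
      of_real (sqrt (of_int p) / t) * qform_theta (QForm a b c) (\<i> * of_real (1 / t))" if "t > 0" for t
    unfolding eq by (rule qform_theta_transform_0[OF a(2) p0 that det])
  show "qform_theta (QForm a b c) ((of_int j + \<i> * of_real t) / of_int p) =
      gauss_sum p j / of_real (t * sqrt (of_int p)) *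
      qform_theta (QForm a b c) ((of_int j' + \<i> * of_real (1 / t)) / of_int p)"
    if "t > 0" "[j * j' = - 1] (mod p)" for t j j'
    unfolding eq using qform_theta_transform[OF a(2) p0 that(1) det that(2)]
      gauss_sum_square_mult[OF p0 r] by simp
qed

text \<open>The growth bound serves twice: crudely, to rearrange the logarithm of the product near
  the cusp, and then to make \<open>B\<close> converge for all \<open>nome z\<close> in the unit
  disc. The identity theorem carries \<open>exp (L z) = F z\<close> from the region above height
  \<open>Y\<close> to the whole half-plane.\<close>

lemma bounded_divisor_sums_level:
  fixes p :: nat and F :: "complex \<Rightarrow> complex" and c :: "nat \<Rightarrow> int" and M \<alpha> :: real
  assumes p: "prime p"
    and holF: "F holomorphic_on {z. Im z > 0}"
    and F0: "\<And>t. t > 0 \<Longrightarrow> F (\<i> * of_real t / of_nat p) = of_real (sqrt p / t) * F (\<i> * of_real (1 / t))"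
    and F1: "\<And>t j j'. t > 0 \<Longrightarrow> [int j * int j' = - 1] (mod int p) \<Longrightarrow>
      F ((of_nat j + \<i> * of_real t) / of_nat p) = g j / of_real t * F ((of_nat j' + \<i> * of_real (1 / t)) / of_nat p)"
    and prod: "has_product_exponents F c"
    and bound: "\<And>n. n \<ge> 1 \<Longrightarrow> \<bar>\<Sum>d | d dvd n. real d * real_of_int (c d)\<bar> \<le> M * real n powr \<alpha>"
  shows "p = 23"
proof -
  define b where "b = (\<lambda>n. \<Sum>d | d dvd n. real d * real_of_int (c d))"
  define H where "H = {z::complex. Im z > 0}"
  have H: "open H" "connected H"
    unfolding H_def by (auto simp: open_halfspace_Im_gt convex_halfspace_Im_gt intro: convex_connected)
  have b: "\<bar>b n\<bar> \<le> M * real n powr \<alpha>" if "n \<ge> 1" for n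
    using bound[OF that] by (simp add: b_def)
  have M: "M \<ge> 0" using b[of 1] by simp
  have summable_b: "(\<lambda>n. \<bar>b n / real n\<bar> * x ^ n) summable_on UNIV" if x: "0 \<le> x" "x < 1" for x
  proof (subst summable_on_UNIV_nonneg_real_iff)
    show "summable (\<lambda>n. \<bar>b n / real n\<bar> * x ^ n)"
    proof (rule summable_comparison_test'[where N=1])
      show "summable (\<lambda>n. M * (real n powr \<alpha> * x ^ n))"
        using x by (intro summable_mult summable_powr_geometric)
      fix n :: nat assume n: "n \<ge> 1"
      have "\<bar>b n / real n\<bar> \<le> \<bar>b n\<bar> / 1" unfolding abs_divide using n by (intro divide_left_mono) auto
      also have "\<dots> \<le> M * real n powr \<alpha>" using b[OF n] by simp
      finally show "norm (\<bar>b n / real n\<bar> * x ^ n) \<le> M * (real n powr \<alpha> * x ^ n)"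
        using x mult_right_mono[of "\<bar>b n / real n\<bar>" "M * real n powr \<alpha>" "x ^ n"] by (simp add: abs_mult mult.assoc)
    qed
  qed (use x in auto)
  \<comment> \<open>An exponential bound on \<open>c\<close> is enough near the cusp:
    \<open>n powr \<alpha>\<close> is at most \<open>K * 2 ^ n\<close>, which is the input of
    \<open>divisor_sum_bound_imp_bound\<close>.\<close>
  obtain A where A: "A \<ge> 0" "\<And>n. n \<ge> 1 \<Longrightarrow> \<bar>real n * real_of_int (c n)\<bar> \<le> A * 4 ^ n"
  proof -
    have "Bseq (\<lambda>n. real n powr \<alpha> * (1 / 2) ^ n)"
      by (rule convergent_imp_Bseq[OF convergentI[OF summable_LIMSEQ_zero[OF summable_powr_geometric]]]) auto
    then obtain K where K: "\<And>n. norm (real n powr \<alpha> * (1 / 2) ^ n) \<le> K" unfolding Bseq_def by blast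
    have "K \<ge> 0" using norm_ge_zero K order_trans by blast
    have "\<bar>b n\<bar> \<le> M * K * 2 ^ n" if "n \<ge> 1" for n
    proof -
      have "real n powr \<alpha> = real n powr \<alpha> * (1 / 2) ^ n * 2 ^ n" by (simp add: power_divide)
      also have "\<dots> \<le> K * 2 ^ n" using K[of n] by (intro mult_right_mono) auto
      finally show ?thesis using b[OF that] mult_left_mono[OF _ M] by (fastforce simp: mult.assoc)
    qed
    then have "\<bar>real n * real_of_int (c n)\<bar> \<le> M * K * 4 ^ n" if "n \<ge> 1" for n
      using that M \<open>K \<ge> 0\<close> by (intro divisor_sum_bound_imp_bound) (auto simp: b_def)
    then show ?thesis using that[of "M * K"] M \<open>K \<ge> 0\<close> by simp
  qed
  have cA: "\<bar>real_of_int (c n)\<bar> \<le> A * 4 ^ n" if "n \<ge> 1" for n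
  proof -
    have "1 * \<bar>real_of_int (c n)\<bar> \<le> real n * \<bar>real_of_int (c n)\<bar>" using that by (intro mult_right_mono) auto
    then show ?thesis using A(2)[OF that] by (simp add: abs_mult)
  qed
  have norm_nome: "norm (nome z) = exp (- (2 * pi * Im z))" for z by (simp add: nome_def)
  define B where "B = (\<lambda>z. \<Sum>\<^sub>\<infinity>N. of_real (b N / real N) * nome z ^ N)"
  define L where "L = (\<lambda>z. 2 * of_real pi * \<i> * z - B z)"
  have holB: "B holomorphic_on H"
    unfolding B_def
  proof (rule holomorphic_on_infsum)
    show "(\<lambda>z. of_real (b N / real N) * nome z ^ N) holomorphic_on H" for N
      unfolding nome_def by (intro holomorphic_intros)
    fix z assume "z \<in> H"
    then have z: "Im z > 0" by (simp add: H_def)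
    have near: "Im w \<ge> Im z / 2" if "w \<in> cball z (Im z / 2)" for w
      using that abs_Im_le_cmod[of "z - w"] by (simp add: dist_norm)
    show "\<exists>r>0. \<exists>M. cball z r \<subseteq> H \<and> M summable_on UNIV \<and>
        (\<forall>N\<in>UNIV. \<forall>w\<in>cball z r. norm (of_real (b N / real N) * nome w ^ N) \<le> M N)"
    proof (intro exI[of _ "Im z / 2"] exI[of _ "\<lambda>N. \<bar>b N / real N\<bar> * exp (- (pi * Im z)) ^ N"] conjI ballI)
      show "cball z (Im z / 2) \<subseteq> H" using near z by (force simp: H_def)
      show "(\<lambda>N. \<bar>b N / real N\<bar> * exp (- (pi * Im z)) ^ N) summable_on UNIV"
        using z by (intro summable_b) auto
      fix N w assume w: "w \<in> cball z (Im z / 2)"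
      have "pi * Im z \<le> 2 * pi * Im w" using near[OF w] by simp
      then have "norm (nome w) \<le> exp (- (pi * Im z))" by (simp add: norm_nome)
      then show "norm (of_real (b N / real N) * nome w ^ N) \<le> \<bar>b N / real N\<bar> * exp (- (pi * Im z)) ^ N"
        unfolding norm_mult norm_power norm_of_real by (intro mult_left_mono power_mono) auto
    qed (use z in auto)
  qed
  have holL: "L holomorphic_on H" unfolding L_def by (intro holomorphic_intros holB)
  have per: "L (z + 1) = L z + 2 * of_real pi * \<i>" for z
  proof -
    have "nome (z + 1) = nome z" by (simp add: nome_def distrib_left exp_add)
    then show ?thesis by (simp add: L_def B_def algebra_simps)
  qed
  obtain \<epsilon> where \<epsilon>: "\<epsilon> > 0" "\<And>z. Im z > 0 \<Longrightarrow> norm (nome z) < \<epsilon> \<Longrightarrow>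
      F z = nome z * (\<Prod>n. (1 - nome z ^ Suc n) powi c (Suc n))"
    using prod unfolding has_product_exponents_def by blast
  \<comment> \<open>Small enough for both the given product formula and the rearrangement at
    \<open>1 / 8\<close>; \<open>Y\<close> is the height above which \<open>nome z\<close> has norm
    below \<open>\<delta>\<close>.\<close>
  define \<delta> where "\<delta> = min \<epsilon> (1 / 8)"
  define Y where "Y = max 0 (- ln \<delta> / (2 * pi))"
  have \<delta>: "\<delta> > 0" using \<epsilon>(1) by (simp add: \<delta>_def)
  have small: "exp (L z) = F z" if z: "Im z > Y" for z
  proof -
    have "- ln \<delta> / (2 * pi) < Im z" "Im z > 0" using z by (auto simp: Y_def)
    then have "- (2 * pi * Im z) < ln \<delta>" by (simp add: field_simps)
    then have "norm (nome z) < exp (ln \<delta>)" unfolding norm_nome by (simp only: exp_less_cancel_iff)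
    then have nome: "norm (nome z) < \<epsilon>" "norm (nome z) \<le> 1 / 8" using \<delta> by (auto simp: \<delta>_def)
    have "F z = nome z * exp (- B z)"
      unfolding \<epsilon>(2)[OF \<open>Im z > 0\<close> nome(1)] B_def b_def
      by (subst prod_powi_eq_exp_divisor_sum[OF nome(2) A(1) cA]) auto
    then show ?thesis by (simp add: L_def exp_diff exp_minus nome_def divide_inverse)
  qed
  have expL: "exp (L z) = F z" if "Im z > 0" for z
  proof (rule analytic_continuation_open[where f="\<lambda>z. exp (L z)" and g=F and s="{z. Im z > Y}" and s'=H])
    have "of_real (Y + 1) * \<i> \<in> {z. Im z > Y}" by simp
    then show "{z. Im z > Y} \<noteq> {}" by blast
    show "{z. Im z > Y} \<subseteq> H" by (auto simp: H_def Y_def)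
    show "(\<lambda>z. exp (L z)) holomorphic_on H" by (intro holomorphic_intros holL)
  qed (use H holF small that in \<open>auto simp: H_def open_halfspace_Im_gt\<close>)
  obtain \<sigma> where \<sigma>: "bij_betw \<sigma> {1..<p} {1..<p}"
    "\<And>j. j \<in> {1..<p} \<Longrightarrow> [int j * int (\<sigma> j) = - 1] (mod int p)"
    using negative_inverse_permutation[OF p] by blast
  show ?thesis
  proof (rule logarithm_of_level_form[where L=L and F=F and g=g and \<sigma>=\<sigma>])
    show "p > 0" using p by (rule prime_gt_0_nat)
    show "L holomorphic_on {z. Im z > 0}" using holL by (simp add: H_def)
    show "F ((of_nat j + \<i> * of_real t) / of_nat p) =
        g j / of_real t * F ((of_nat (\<sigma> j) + \<i> * of_real (1 / t)) / of_nat p)"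
      if "j \<in> {1..<p}" "t > 0" for j t
      using F1[OF that(2) \<sigma>(2)[OF that(1)]] .
  qed (use per expL F0 \<sigma>(1) in auto)
qed

lemma theta_diff_level_23:
  fixes D :: int and e :: "nat \<Rightarrow> int" and M \<alpha> :: real
  assumes D: "prime D" "D mod 4 = 3"
    and P: "P = principal_qform (- D)"
    and R: "R \<in> reduced_qforms (- D)" "qform_conj R \<in> reduced_qforms (- D)" "qform_conj R \<noteq> R"
    and prod: "has_product_exponents (theta_diff P R) e"
    and bound: "\<And>n. n \<ge> 1 \<Longrightarrow> \<bar>\<Sum>d | d dvd n. real d * real_of_int (e d)\<bar> \<le> M * real n powr \<alpha>"
  shows "D = 23"
proof -
  obtain a b c where abc: "R = QForm a b c" by (cases R)
  have ineq: "b \<noteq> 0" "\<bar>b\<bar> < a" "a < c" using non_ambiguous_reduced R abc by blast+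
  have disc: "b\<^sup>2 - 4 * a * c = - D" using R(1) by (simp add: abc reduced_qforms_def qforms_def)
  have oddD: "odd D" using D(2) by presburger
  \<comment> \<open>The principal form already has the odd leading coefficient 1; only
    \<open>R\<close> has to be replaced by an equivalent form before both satisfy the same
    laws.\<close>
  obtain a' b' c' where a': "odd a'" "0 < a'" "a' < D" "b'\<^sup>2 - 4 * a' * c' = - D"
    and eqR: "\<And>z. qform_theta R z = qform_theta (QForm a' b' c') z"
    using odd_leading_coeff[OF ineq(2,3,1) disc oddD] abc by blast
  have eqP: "P = QForm 1 1 ((1 + D) div 4)"
  proof -
    have "- D mod 4 = 1" using D(2) by presburger
    then show ?thesis by (simp add: P principal_qform_def)
  qed
  have disc1: "1\<^sup>2 - 4 * 1 * ((1 + D) div 4) = - D" using D(2) by simp presburger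
  define p where "p = nat D"
  have p: "D = int p" "prime p" using prime_gt_0_int[OF D(1)] D(1) by (auto simp: p_def)
  note theta1 = qform_theta_prime_level[OF D odd_one zero_less_one prime_gt_1_int[OF D(1)] disc1, folded eqP]
  have theta2: "qform_theta R holomorphic_on {z. Im z > 0}"
    "\<And>t. t > 0 \<Longrightarrow> qform_theta R (\<i> * of_real t / of_int D) =
      of_real (sqrt (of_int D) / t) * qform_theta R (\<i> * of_real (1 / t))"
    "\<And>t j j'. t > 0 \<Longrightarrow> [j * j' = - 1] (mod D) \<Longrightarrow> qform_theta R ((of_int j + \<i> * of_real t) / of_int D) =
      gauss_sum D j / of_real (t * sqrt (of_int D)) * qform_theta R ((of_int j' + \<i> * of_real (1 / t)) / of_int D)"
    using qform_theta_prime_level[OF D a'] eqR by (auto cong: holomorphic_cong)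
  have "p = 23"
  proof (rule bounded_divisor_sums_level[where F="theta_diff P R" and g="\<lambda>j. gauss_sum D (int j) / of_real (sqrt p)"])
    show "theta_diff P R holomorphic_on {z. Im z > 0}"
      unfolding theta_diff_def[abs_def] using theta1(1) theta2(1) by (intro holomorphic_intros) auto
    show "theta_diff P R (\<i> * of_real t / of_nat p) = of_real (sqrt p / t) * theta_diff P R (\<i> * of_real (1 / t))"
      if "t > 0" for t
      using theta1(2)[OF that] theta2(2)[OF that] by (simp add: theta_diff_def p(1) algebra_simps diff_divide_distrib)
    show "theta_diff P R ((of_nat j + \<i> * of_real t) / of_nat p) =
        gauss_sum D (int j) / of_real (sqrt p) / of_real t * theta_diff P R ((of_nat j' + \<i> * of_real (1 / t)) / of_nat p)"
      if t: "t > 0" and j: "[int j * int j' = - 1] (mod int p)" for t j j'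
      using theta1(3)[OF t, of "int j" "int j'"] theta2(3)[OF t, of "int j" "int j'"] j
      by (simp add: theta_diff_def p(1) right_diff_distrib diff_divide_distrib mult.commute)
  qed (use p prod bound in auto)
  then show ?thesis using p by simp
qed

theorem theorem1p4:
  fixes D :: int and k r :: nat and Q :: "nat \<Rightarrow> qform" and c :: "nat \<Rightarrow> int"
  assumes "D > 0" and "- D \<noteq> - 23" and "fundamental_discriminant (- D)"
    and "class_number (- D) = 2 * k + 1" and "2 * k + 1 > 1"
    and "Q 0 = principal_qform (- D)"
    and "distinct (Q 0 # concat (map (\<lambda>i. [Q i, qform_conj (Q i)]) [1..<Suc k]))"
    and "set (Q 0 # concat (map (\<lambda>i. [Q i, qform_conj (Q i)]) [1..<Suc k])) =
           reduced_qforms (- D)"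
    and "1 \<le> r" and "r \<le> k"
    and "has_product_exponents (theta_diff (Q 0) (Q r)) c"
  shows "\<not> bounded ((\<lambda>n. real_of_int (c n)) ` {1..}) \<and>
    (\<forall>\<alpha>::real. \<not> bounded ((\<lambda>n::nat.
        1 / real n powr \<alpha> * (\<Sum>d | d dvd n. real d * real_of_int (c d))) ` {1..}))"
proof -
  let ?pairs = "map (\<lambda>i. [Q i, qform_conj (Q i)]) [1..<Suc k]"
  define T where "T = set (concat ?pairs)"
  have T_iff: "S \<in> T \<longleftrightarrow> (\<exists>i\<in>{1..<Suc k}. S = Q i \<or> S = qform_conj (Q i))" for S
    unfolding T_def by (auto simp del: upt_Suc)
  have reduced: "reduced_qforms (- D) = insert (Q 0) T"
    using assms(8) by (simp only: T_def list.set(2))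
  have Q0: "Q 0 \<notin> T" using assms(7) by (simp only: T_def distinct.simps simp_thms)
  \<comment> \<open>Distinctness of the list separates each \<open>Q i\<close> from its conjugate,
    so the listed pairs say that no nonprincipal reduced form is ambiguous.\<close>
  have conj: "qform_conj S \<in> reduced_qforms (- D) \<and> qform_conj S \<noteq> S"
    if S: "S \<in> reduced_qforms (- D)" "S \<noteq> principal_qform (- D)" for S
  proof -
    have "S \<in> T" using S assms(6) unfolding reduced by blast
    then obtain i where i: "i \<in> {1..<Suc k}" "S = Q i \<or> S = qform_conj (Q i)" unfolding T_iff by blast
    have "distinct (concat ?pairs)" using assms(7) by (simp only: distinct.simps)
    moreover have "[Q i, qform_conj (Q i)] \<in> set ?pairs" using i(1) by (simp del: upt_Suc)
    ultimately have "distinct [Q i, qform_conj (Q i)]" unfolding distinct_concat_iff by blast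
    moreover have "Q i \<in> T" "qform_conj (Q i) \<in> T" unfolding T_iff using i(1) by blast+
    moreover have "qform_conj (qform_conj (Q i)) = Q i" by (cases "Q i") simp
    ultimately show ?thesis using i(2) unfolding reduced by auto
  qed
  have "Q r \<in> T" unfolding T_iff using assms(9,10) by auto
  then have R: "Q r \<in> reduced_qforms (- D)" "Q r \<noteq> principal_qform (- D)"
    using Q0 assms(6) unfolding reduced by auto
  have D: "prime D" "D mod 4 = 3" using prime_discriminant[OF assms(1,3) conj R] by simp_all
  have unbounded: False
    if "\<And>n. n \<ge> 1 \<Longrightarrow> \<bar>\<Sum>d | d dvd n. real d * real_of_int (c d)\<bar> \<le> M * real n powr \<alpha>" for M \<alpha> :: real
    using theta_diff_level_23[OF D assms(6) R(1) conjunct1[OF conj[OF R]] conjunct2[OF conj[OF R]] assms(11) that]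
      assms(2) by simp
  have "\<not> bounded ((\<lambda>n. real_of_int (c n)) ` {1..})"
  proof
    assume "bounded ((\<lambda>n. real_of_int (c n)) ` {1..})"
    then obtain M where M: "\<And>n. n \<ge> 1 \<Longrightarrow> \<bar>real_of_int (c n)\<bar> \<le> M" by (auto simp: bounded_iff)
    have "M \<ge> 0" using M[of 1] by simp
    show False
    \<comment> \<open>There are at most \<open>n\<close> divisors and each contributes at most
      \<open>n * M\<close>, whence the exponent 2.\<close>
    proof (rule unbounded[of M 2])
      fix n :: nat assume n: "n \<ge> 1"
      have "\<bar>\<Sum>d | d dvd n. real d * real_of_int (c d)\<bar> \<le> (\<Sum>d | d dvd n. \<bar>real d * real_of_int (c d)\<bar>)"
        by (rule sum_abs)
      also have "\<dots> \<le> (\<Sum>d | d dvd n. real n * M)"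
      proof (rule sum_mono)
        fix d assume "d \<in> {d. d dvd n}"
        then have "d \<ge> 1" "d \<le> n" using n by (auto simp: Suc_le_eq dvd_imp_le intro: Nat.gr0I)
        then show "\<bar>real d * real_of_int (c d)\<bar> \<le> real n * M"
          unfolding abs_mult using M[of d] by (intro mult_mono) auto
      qed
      also have "\<dots> \<le> (\<Sum>d\<in>{1..n}. real n * M)"
        using n \<open>M \<ge> 0\<close> by (intro sum_mono2) (auto simp: Suc_le_eq dvd_imp_le intro: Nat.gr0I)
      also have "\<dots> = M * real n powr 2" using n by (simp add: powr_numeral power2_eq_square)
      finally show "\<bar>\<Sum>d | d dvd n. real d * real_of_int (c d)\<bar> \<le> M * real n powr 2" .
    qed
  qed
  moreover have "\<not> bounded ((\<lambda>n::nat. 1 / real n powr \<alpha> * (\<Sum>d | d dvd n. real d * real_of_int (c d))) ` {1..})" for \<alpha>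
  proof
    assume "bounded ((\<lambda>n::nat. 1 / real n powr \<alpha> * (\<Sum>d | d dvd n. real d * real_of_int (c d))) ` {1..})"
    then obtain M where M: "\<And>n::nat. n \<ge> 1 \<Longrightarrow>
        \<bar>1 / real n powr \<alpha> * (\<Sum>d | d dvd n. real d * real_of_int (c d))\<bar> \<le> M"
      by (auto simp: bounded_iff)
    show False
    proof (rule unbounded[of M \<alpha>])
      fix n :: nat assume n: "n \<ge> 1"
      then show "\<bar>\<Sum>d | d dvd n. real d * real_of_int (c d)\<bar> \<le> M * real n powr \<alpha>"
        using M[OF n] by (simp add: abs_mult pos_divide_le_eq)
    qed
  qed
  ultimately show ?thesis by blast
qed

end
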